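(* There exists a constant $c$ such that $\mathsf{PA}$ together with all true statements of the form "$\mathrm{C}(x|y)\ge c$" (for binary strings $x,y$) proves all true $\mathrm{\Pi}_1$-statements.
   Context: $\mathsf{PA}$ is Peano arithmetic; "true" means true in the standard model. $\mathrm{C}(x|y)$ is conditional plain Kolmogorov complexity: the length of a shortest program that maps $y$ to $x$ with respect to a fixed optimal (up to an additive constant) interpreter, represented in $\mathsf{PA}$ in the natural way so that its standard properties (e.g., optimality) are provable in $\mathsf{PA}$. *)

theory Defs
  imports Complex_Main "HOL-Library.Extended_Nat"
begin

section \<open>Interpreters and conditional plain Kolmogorov complexity\<close>

text \<open>The standard bijection between binary strings and natural numbers
  (bijective base 2, least significant digit first).
  A string of length \<open>n\<close> has a code in \<open>{2^n - 1 ..< 2^(n+1) - 1}\<close>.\<close>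

primrec code :: "bool list \<Rightarrow> nat" where
  "code [] = 0"
| "code (b # bs) = 2 * code bs + (if b then 2 else 1)"

datatype recf = PZero | PSucc | PProj nat | PComp recf "recf list" | PRec recf recf | PMin recf

inductive computes :: "recf \<Rightarrow> nat list \<Rightarrow> nat \<Rightarrow> bool" where
  "computes PZero xs 0"
| "computes PSucc (x # xs) (Suc x)"
| "i < length xs \<Longrightarrow> computes (PProj i) xs (xs ! i)"
| "length ys = length gs \<Longrightarrow> (\<forall>i < length gs. computes (gs ! i) xs (ys ! i)) \<Longrightarrow>
     computes f ys z \<Longrightarrow> computes (PComp f gs) xs z"
| "computes f xs z \<Longrightarrow> computes (PRec f g) (0 # xs) z"
| "computes (PRec f g) (n # xs) r \<Longrightarrow> computes g (n # r # xs) z \<Longrightarrow>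
     computes (PRec f g) (Suc n # xs) z"
| "computes f (n # xs) 0 \<Longrightarrow> (\<forall>m < n. \<exists>k. computes f (m # xs) (Suc k)) \<Longrightarrow>
     computes (PMin f) xs n"

text \<open>\<open>U p y = Some x\<close>: program \<open>p\<close> maps condition \<open>y\<close> to \<open>x\<close>.\<close>

type_synonym interpreter = "bool list \<Rightarrow> bool list \<Rightarrow> bool list option"

definition computable :: "interpreter \<Rightarrow> bool" where
  "computable V \<longleftrightarrow>
     (\<exists>f. \<forall>p y x. V p y = Some x \<longleftrightarrow> computes f [code p, code y] (code x))"

text \<open>\<open>KC U x y\<close> is \<open>C(x|y)\<close> with respect to \<open>U\<close>; it is \<open>\<infinity>\<close> if no program maps \<open>y\<close> to \<open>x\<close>.\<close>

definition KC :: "interpreter \<Rightarrow> bool list \<Rightarrow> bool list \<Rightarrow> enat" where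
  "KC U x y = (INF p \<in> {p. U p y = Some x}. enat (length p))"

definition optimal_interpreter :: "interpreter \<Rightarrow> bool" where
  "optimal_interpreter U \<longleftrightarrow> computable U \<and>
     (\<forall>V. computable V \<longrightarrow> (\<exists>d::nat. \<forall>x y. KC U x y \<le> KC V x y + enat d))"

section \<open>The language of arithmetic\<close>

text \<open>Variables are de Bruijn indices.\<close>

datatype tm = Var nat | Zero | Succ tm | Plus tm tm | Times tm tm

datatype fm = Eq tm tm | Less tm tm | Falsum | Imp fm fm | All fm

abbreviation Neg :: "fm \<Rightarrow> fm" where "Neg \<phi> \<equiv> Imp \<phi> Falsum"
abbreviation Disj :: "fm \<Rightarrow> fm \<Rightarrow> fm" where "Disj \<phi> \<psi> \<equiv> Imp (Neg \<phi>) \<psi>"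
abbreviation Conj :: "fm \<Rightarrow> fm \<Rightarrow> fm" where "Conj \<phi> \<psi> \<equiv> Neg (Imp \<phi> (Neg \<psi>))"
abbreviation Iff :: "fm \<Rightarrow> fm \<Rightarrow> fm" where "Iff \<phi> \<psi> \<equiv> Conj (Imp \<phi> \<psi>) (Imp \<psi> \<phi>)"
abbreviation Ex :: "fm \<Rightarrow> fm" where "Ex \<phi> \<equiv> Neg (All (Neg \<phi>))"

primrec tsubst :: "(nat \<Rightarrow> tm) \<Rightarrow> tm \<Rightarrow> tm" where
  "tsubst \<sigma> (Var n) = \<sigma> n"
| "tsubst \<sigma> Zero = Zero"
| "tsubst \<sigma> (Succ t) = Succ (tsubst \<sigma> t)"
| "tsubst \<sigma> (Plus s t) = Plus (tsubst \<sigma> s) (tsubst \<sigma> t)"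
| "tsubst \<sigma> (Times s t) = Times (tsubst \<sigma> s) (tsubst \<sigma> t)"

definition tlift :: "tm \<Rightarrow> tm" where
  "tlift = tsubst (\<lambda>n. Var (Suc n))"

definition slift :: "(nat \<Rightarrow> tm) \<Rightarrow> nat \<Rightarrow> tm" where
  "slift \<sigma> n = (case n of 0 \<Rightarrow> Var 0 | Suc m \<Rightarrow> tlift (\<sigma> m))"

primrec subst :: "(nat \<Rightarrow> tm) \<Rightarrow> fm \<Rightarrow> fm" where
  "subst \<sigma> (Eq s t) = Eq (tsubst \<sigma> s) (tsubst \<sigma> t)"
| "subst \<sigma> (Less s t) = Less (tsubst \<sigma> s) (tsubst \<sigma> t)"
| "subst \<sigma> Falsum = Falsum"
| "subst \<sigma> (Imp \<phi> \<psi>) = Imp (subst \<sigma> \<phi>) (subst \<sigma> \<psi>)"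
| "subst \<sigma> (All \<phi>) = All (subst (slift \<sigma>) \<phi>)"

definition lift :: "fm \<Rightarrow> fm" where
  "lift = subst (\<lambda>n. Var (Suc n))"

text \<open>\<open>inst [t\<^sub>0, \<dots>, t\<^sub>k]\<close> replaces the first \<open>k + 1\<close> variables and lowers all others.\<close>

definition inst :: "tm list \<Rightarrow> fm \<Rightarrow> fm" where
  "inst ts = subst (\<lambda>n. if n < length ts then ts ! n else Var (n - length ts))"

text \<open>\<open>twf n\<close> and \<open>fwf n\<close>: all free variables are below \<open>n\<close>.\<close>

primrec twf :: "nat \<Rightarrow> tm \<Rightarrow> bool" where
  "twf n (Var m) \<longleftrightarrow> m < n"
| "twf n Zero \<longleftrightarrow> True"
| "twf n (Succ t) \<longleftrightarrow> twf n t"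
| "twf n (Plus s t) \<longleftrightarrow> twf n s \<and> twf n t"
| "twf n (Times s t) \<longleftrightarrow> twf n s \<and> twf n t"

primrec fwf :: "nat \<Rightarrow> fm \<Rightarrow> bool" where
  "fwf n (Eq s t) \<longleftrightarrow> twf n s \<and> twf n t"
| "fwf n (Less s t) \<longleftrightarrow> twf n s \<and> twf n t"
| "fwf n Falsum \<longleftrightarrow> True"
| "fwf n (Imp \<phi> \<psi>) \<longleftrightarrow> fwf n \<phi> \<and> fwf n \<psi>"
| "fwf n (All \<phi>) \<longleftrightarrow> fwf (Suc n) \<phi>"

abbreviation sentence :: "fm \<Rightarrow> bool" where "sentence \<equiv> fwf 0"

primrec num :: "nat \<Rightarrow> tm" where
  "num 0 = Zero"
| "num (Suc n) = Succ (num n)"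

section \<open>Truth in the standard model\<close>

primrec eval :: "(nat \<Rightarrow> nat) \<Rightarrow> tm \<Rightarrow> nat" where
  "eval e (Var n) = e n"
| "eval e Zero = 0"
| "eval e (Succ t) = Suc (eval e t)"
| "eval e (Plus s t) = eval e s + eval e t"
| "eval e (Times s t) = eval e s * eval e t"

primrec sat :: "(nat \<Rightarrow> nat) \<Rightarrow> fm \<Rightarrow> bool" where
  "sat e (Eq s t) \<longleftrightarrow> eval e s = eval e t"
| "sat e (Less s t) \<longleftrightarrow> eval e s < eval e t"
| "sat e Falsum \<longleftrightarrow> False"
| "sat e (Imp \<phi> \<psi>) \<longleftrightarrow> (sat e \<phi> \<longrightarrow> sat e \<psi>)"
| "sat e (All \<phi>) \<longleftrightarrow> (\<forall>a. sat (case_nat a e) \<phi>)"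

definition true_in_N :: "fm \<Rightarrow> bool" where
  "true_in_N \<phi> \<longleftrightarrow> (\<forall>e. sat e \<phi>)"

section \<open>Arithmetical hierarchy\<close>

abbreviation BAll :: "tm \<Rightarrow> fm \<Rightarrow> fm" where
  "BAll t \<phi> \<equiv> All (Imp (Less (Var 0) (tlift t)) \<phi>)"
abbreviation BEx :: "tm \<Rightarrow> fm \<Rightarrow> fm" where
  "BEx t \<phi> \<equiv> Neg (BAll t (Neg \<phi>))"

inductive Delta0 :: "fm \<Rightarrow> bool" where
  "Delta0 (Eq s t)"
| "Delta0 (Less s t)"
| "Delta0 Falsum"
| "Delta0 \<phi> \<Longrightarrow> Delta0 \<psi> \<Longrightarrow> Delta0 (Imp \<phi> \<psi>)"
| "Delta0 \<phi> \<Longrightarrow> Delta0 (BAll t \<phi>)"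

inductive Sigma1 :: "fm \<Rightarrow> bool" where
  "Delta0 \<phi> \<Longrightarrow> Sigma1 \<phi>"
| "Sigma1 \<phi> \<Longrightarrow> Sigma1 (Ex \<phi>)"

inductive Pi1 :: "fm \<Rightarrow> bool" where
  "Delta0 \<phi> \<Longrightarrow> Pi1 \<phi>"
| "Pi1 \<phi> \<Longrightarrow> Pi1 (All \<phi>)"

section \<open>Provability and Peano arithmetic\<close>

inductive proves :: "fm set \<Rightarrow> fm \<Rightarrow> bool" (infix "\<turnstile>" 50) where
  Assm: "\<phi> \<in> \<Gamma> \<Longrightarrow> \<Gamma> \<turnstile> \<phi>"
| ImpI: "insert \<phi> \<Gamma> \<turnstile> \<psi> \<Longrightarrow> \<Gamma> \<turnstile> Imp \<phi> \<psi>"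
| ImpE: "\<Gamma> \<turnstile> Imp \<phi> \<psi> \<Longrightarrow> \<Gamma> \<turnstile> \<phi> \<Longrightarrow> \<Gamma> \<turnstile> \<psi>"
| Classical: "insert (Neg \<phi>) \<Gamma> \<turnstile> Falsum \<Longrightarrow> \<Gamma> \<turnstile> \<phi>"
| AllI: "lift ` \<Gamma> \<turnstile> \<phi> \<Longrightarrow> \<Gamma> \<turnstile> All \<phi>"
| AllE: "\<Gamma> \<turnstile> All \<phi> \<Longrightarrow> \<Gamma> \<turnstile> inst [t] \<phi>"
| Refl: "\<Gamma> \<turnstile> Eq t t"
| EqE: "\<Gamma> \<turnstile> Eq s t \<Longrightarrow> \<Gamma> \<turnstile> inst [s] \<phi> \<Longrightarrow> \<Gamma> \<turnstile> inst [t] \<phi>"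

definition Robinson :: "fm set" where
  "Robinson =
    {All (Neg (Eq (Succ (Var 0)) Zero)),
     All (All (Imp (Eq (Succ (Var 1)) (Succ (Var 0))) (Eq (Var 1) (Var 0)))),
     All (Eq (Plus (Var 0) Zero) (Var 0)),
     All (All (Eq (Plus (Var 1) (Succ (Var 0))) (Succ (Plus (Var 1) (Var 0))))),
     All (Eq (Times (Var 0) Zero) Zero),
     All (All (Eq (Times (Var 1) (Succ (Var 0))) (Plus (Times (Var 1) (Var 0)) (Var 1)))),
     All (Neg (Less (Var 0) Zero)),
     All (All (Iff (Less (Var 1) (Succ (Var 0)))
                   (Disj (Less (Var 1) (Var 0)) (Eq (Var 1) (Var 0)))))}"

text \<open>Induction on variable 0; the other free variables of \<open>\<phi>\<close> are parameters, and \<open>PA\<close>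
  contains the universal closures.\<close>

definition induction_fm :: "fm \<Rightarrow> fm" where
  "induction_fm \<phi> =
     Imp (inst [Zero] \<phi>)
    (Imp (All (Imp \<phi> (subst (case_nat (Succ (Var 0)) (\<lambda>n. Var (Suc n))) \<phi>)))
         (All \<phi>))"

definition PA :: "fm set" where
  "PA = Robinson \<union>
     {(All ^^ n) (induction_fm \<phi>) | n \<phi>. sentence ((All ^^ n) (induction_fm \<phi>))}"

section \<open>Kolmogorov complexity in Peano arithmetic\<close>

text \<open>Strings are represented by their codes.  The length \<open>l\<close> of the string with code \<open>p\<close> enters
  through \<open>u = 2^l\<close>, the power of two with \<open>u \<le> p + 1 < 2u\<close>, which is definable by a bounded formula
  without reference to the exponential function: the powers of two are the positive numbers all of
  whose divisors are 1 or even.\<close>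

definition pow2_fm :: "tm \<Rightarrow> fm" where
  "pow2_fm u = Conj (Less Zero u)
     (BAll (Succ u) (BAll (Succ (tlift u))
        (Imp (Eq (Times (Var 1) (Var 0)) (tlift (tlift u)))
             (Disj (Eq (Var 1) (num 1))
                   (BEx (Succ (Var 1)) (Eq (Var 2) (Plus (Var 0) (Var 0))))))))"

definition pow2_length_fm :: "tm \<Rightarrow> tm \<Rightarrow> fm" where
  "pow2_length_fm p u =
     Conj (pow2_fm u) (Conj (Less u (Succ (Succ p))) (Less (Succ p) (Plus u u)))"

text \<open>\<open>|p| < c\<close>\<close>

definition length_less_fm :: "tm \<Rightarrow> nat \<Rightarrow> fm" where
  "length_less_fm p c =
     Ex (Conj (pow2_length_fm (tlift p) (Var 0)) (Less (Var 0) (num (2 ^ c))))"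

text \<open>\<open>|q| \<le> |p| + d\<close>\<close>

definition length_le_fm :: "tm \<Rightarrow> tm \<Rightarrow> nat \<Rightarrow> fm" where
  "length_le_fm q p d =
     Ex (Ex (Conj (pow2_length_fm (tlift (tlift q)) (Var 1))
            (Conj (pow2_length_fm (tlift (tlift p)) (Var 0))
                  (Less (Var 1) (Succ (Times (num (2 ^ d)) (Var 0)))))))"

text \<open>A formula \<open>\<psi>\<close> with free variables 0, 1, 2 stands for ``program 0 maps condition 1
  to output 2''.\<close>

definition functional_fm :: "fm \<Rightarrow> fm" where
  "functional_fm \<psi> = All (All (All (All
     (Imp (inst [Var 3, Var 2, Var 1] \<psi>)
     (Imp (inst [Var 3, Var 2, Var 0] \<psi>)
          (Eq (Var 1) (Var 0)))))))"

definition simulates_fm :: "fm \<Rightarrow> fm \<Rightarrow> nat \<Rightarrow> fm" where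
  "simulates_fm \<upsilon> \<psi> d = All (All (All
     (Imp (inst [Var 2, Var 1, Var 0] \<psi>)
          (Ex (Conj (length_le_fm (Var 0) (Var 3) d)
                    (inst [Var 0, Var 2, Var 1] \<upsilon>))))))"

text \<open>\<open>\<upsilon>\<close> is a representation of the interpreter \<open>U\<close> whose standard properties are provable in
  Peano arithmetic: \<open>\<upsilon>\<close> is a partial function, and it is optimal, i.e. it simulates
  every (provably functional) computably enumerable \<open>\<psi>\<close> with a constant overhead in program length.\<close>

definition natural_representation :: "fm \<Rightarrow> interpreter \<Rightarrow> bool" where
  "natural_representation \<upsilon> U \<longleftrightarrow>
     Sigma1 \<upsilon> \<and> fwf 3 \<upsilon> \<and>
     (\<forall>p y x. true_in_N (inst [num (code p), num (code y), num (code x)] \<upsilon>)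
              \<longleftrightarrow> U p y = Some x) \<and>
     PA \<turnstile> functional_fm \<upsilon> \<and>
     (\<forall>\<psi>. Sigma1 \<psi> \<and> fwf 3 \<psi> \<and> PA \<turnstile> functional_fm \<psi> \<longrightarrow>
        (\<exists>d. PA \<turnstile> simulates_fm \<upsilon> \<psi> d))"

text \<open>The statement \<open>C(x|y) \<ge> c\<close>: no program of length less than \<open>c\<close> maps \<open>y\<close> to \<open>x\<close>.\<close>

definition KC_ge_fm :: "fm \<Rightarrow> bool list \<Rightarrow> bool list \<Rightarrow> nat \<Rightarrow> fm" where
  "KC_ge_fm \<upsilon> x y c =
     All (Imp (length_less_fm (Var 0) c)
              (Neg (inst [Var 0, num (code y), num (code x)] \<upsilon>)))"

section \<open>Adequacy of the encodings\<close>

lemma eval_num [simp]: "eval e (num n) = n"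
  by (induction n) auto

lemma eval_tsubst: "eval e (tsubst \<sigma> t) = eval (\<lambda>n. eval e (\<sigma> n)) t"
  by (induction t) auto

lemma eval_tlift [simp]: "eval (case_nat a e) (tlift t) = eval e t"
  by (simp add: tlift_def eval_tsubst)

lemma sat_subst: "sat e (subst \<sigma> \<phi>) \<longleftrightarrow> sat (\<lambda>n. eval e (\<sigma> n)) \<phi>"
proof (induction \<phi> arbitrary: e \<sigma>)
  case (All \<phi>)
  have "(\<lambda>n. eval (case_nat a e) (slift \<sigma> n)) = case_nat a (\<lambda>n. eval e (\<sigma> n))" for a
    by (auto simp: slift_def fun_eq_iff split: nat.split)
  then show ?case using All by simp
qed (auto simp: eval_tsubst)

lemma sat_lift [simp]: "sat (case_nat a e) (lift \<phi>) = sat e \<phi>"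
  by (simp add: lift_def sat_subst)

lemma eval_cong: "twf k t \<Longrightarrow> (\<And>n. n < k \<Longrightarrow> e n = e' n) \<Longrightarrow> eval e t = eval e' t"
  by (induction t) auto

lemma sat_cong: "fwf k \<phi> \<Longrightarrow> (\<And>n. n < k \<Longrightarrow> e n = e' n) \<Longrightarrow> sat e \<phi> = sat e' \<phi>"
proof (induction \<phi> arbitrary: k e e')
  case (All \<phi>)
  have "sat (case_nat a e) \<phi> = sat (case_nat a e') \<phi>" for a
    using All.prems by (intro All.IH[of "Suc k"]) (auto split: nat.split)
  then show ?case by simp
next
  case (Imp \<phi>1 \<phi>2)
  have "sat e \<phi>1 = sat e' \<phi>1" "sat e \<phi>2 = sat e' \<phi>2"
    using Imp.prems by (auto intro!: Imp.IH(1)[of k] Imp.IH(2)[of k])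
  then show ?case by simp
next
  case (Eq s t)
  then show ?case using eval_cong[of k s e e'] eval_cong[of k t e e'] by simp
next
  case (Less s t)
  then show ?case using eval_cong[of k s e e'] eval_cong[of k t e e'] by simp
qed auto

lemma sat_inst1: "sat e (inst [t] \<phi>) \<longleftrightarrow> sat (case_nat (eval e t) e) \<phi>"
proof -
  have "(\<lambda>n. eval e (if n < length [t] then [t] ! n else Var (n - length [t]))) =
        case_nat (eval e t) e"
    by (auto simp: fun_eq_iff split: nat.split)
  then show ?thesis by (simp add: inst_def sat_subst)
qed

lemma proves_sound: "\<Gamma> \<turnstile> \<phi> \<Longrightarrow> (\<forall>\<psi>\<in>\<Gamma>. sat e \<psi>) \<Longrightarrow> sat e \<phi>"
  by (induction arbitrary: e rule: proves.induct) (auto simp: sat_inst1)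

lemma sat_All_pow: "(\<And>e. sat e \<phi>) \<Longrightarrow> sat e ((All ^^ n) \<phi>)"
  by (induction n arbitrary: e) auto

lemma sat_induction_fm: "sat e (induction_fm \<phi>)"
proof -
  have *: "(\<lambda>n. eval (case_nat a e) (case n of 0 \<Rightarrow> Succ (Var 0) | Suc n \<Rightarrow> Var (Suc n))) =
    case_nat (Suc a) e" for a
    by (auto simp: fun_eq_iff split: nat.split)
  have "sat (case_nat a e) \<phi>"
    if "sat (case_nat 0 e) \<phi>"
      "\<forall>a. sat (case_nat a e) \<phi> \<longrightarrow> sat (case_nat (Suc a) e) \<phi>" for a
    using that by (induction a) auto
  note ind = this
  show ?thesis
    unfolding induction_fm_def sat.simps sat_inst1 sat_subst * eval.simps
    by (intro impI allI) (rule ind)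
qed

lemma sat_PA: "\<phi> \<in> PA \<Longrightarrow> sat e \<phi>"
  by (auto simp: PA_def Robinson_def sat_induction_fm intro!: sat_All_pow)

lemma pow2_iff:
  "(\<exists>k. u = 2 ^ k) \<longleftrightarrow> 0 < u \<and> (\<forall>v. v dvd u \<longrightarrow> v = 1 \<or> even v)" for u :: nat
proof
  assume "\<exists>k. u = 2 ^ k"
  then obtain k where k: "u = 2 ^ k" ..
  have "v = 1 \<or> even v" if v: "v dvd u" for v
  proof (rule disjCI)
    assume "odd v"
    then have "coprime v (2 ^ k)" by simp
    then show "v = 1" using v k by (metis coprime_absorb_left nat_dvd_1_iff_1)
  qed
  then show "0 < u \<and> (\<forall>v. v dvd u \<longrightarrow> v = 1 \<or> even v)" using k by simp
next
  show "0 < u \<and> (\<forall>v. v dvd u \<longrightarrow> v = 1 \<or> even v) \<Longrightarrow> \<exists>k. u = 2 ^ k"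
  proof (induction u rule: less_induct)
    case (less u)
    show ?case
    proof (cases "u = 1")
      case True
      then show ?thesis by (intro exI[of _ 0]) simp
    next
      case False
      then have "even u" using less.prems by (metis dvd_refl)
      then obtain w where w: "u = 2 * w" by blast
      have "\<exists>k. w = 2 ^ k" using less.prems w by (intro less.IH) auto
      then show ?thesis using w by (metis power_Suc)
    qed
  qed
qed

lemma sat_pow2_fm [simp]: "sat e (pow2_fm t) \<longleftrightarrow> (\<exists>k. eval e t = 2 ^ k)"
proof -
  define u where "u = eval e t"
  have ev: "(\<exists>k < Suc v. v = k + k) \<longleftrightarrow> even v" for v :: nat
    by (metis even_add le_add1 less_Suc_eq_le mult_2 evenE)
  have "sat e (pow2_fm t) \<longleftrightarrow>
    0 < u \<and> (\<forall>v < Suc u. \<forall>w < Suc u. v * w = u \<longrightarrow> v = 1 \<or> (\<exists>k < Suc v. v = k + k))"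
    unfolding pow2_fm_def u_def by auto
  also have "\<dots> \<longleftrightarrow> 0 < u \<and> (\<forall>v. v dvd u \<longrightarrow> v = 1 \<or> even v)"
  proof -
    have "(\<forall>v < Suc u. \<forall>w < Suc u. v * w = u \<longrightarrow> Q v) \<longleftrightarrow> (\<forall>v. v dvd u \<longrightarrow> Q v)"
      if "0 < u" for Q
    proof -
      have "v < Suc u \<and> w < Suc u" if "v * w = u" for v w
        using that \<open>0 < u\<close> by (metis dvd_imp_le dvd_triv_left dvd_triv_right less_Suc_eq_le)
      then show ?thesis unfolding dvd_def by metis
    qed
    then show ?thesis unfolding ev by (rule conj_cong[OF refl])
  qed
  finally show ?thesis unfolding u_def pow2_iff .
qed

lemma code_length: "2 ^ length p \<le> code p + 1 \<and> code p + 1 < 2 * 2 ^ length p"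
  by (induction p) auto

lemma pow2_unique:
  assumes "2 ^ k \<le> (n::nat)" "n < 2 * 2 ^ k" "2 ^ l \<le> n" "n < 2 * 2 ^ l"
  shows "k = l"
proof -
  have "(2::nat) ^ k < 2 ^ Suc l" "(2::nat) ^ l < 2 ^ Suc k" using assms by auto
  then have "k < Suc l" "l < Suc k" by (simp_all only: power_strict_increasing_iff)
  then show ?thesis by simp
qed

lemma sat_pow2_length_fm:
  assumes "eval e t = code p"
  shows "sat e (pow2_length_fm t s) \<longleftrightarrow> eval e s = 2 ^ length p"
proof -
  have "sat e (pow2_length_fm t s) \<longleftrightarrow>
    (\<exists>k. eval e s = 2 ^ k \<and> 2 ^ k \<le> code p + 1 \<and> code p + 1 < 2 * 2 ^ k)"
    using assms by (simp add: pow2_length_fm_def less_Suc_eq_le) (metis mult_2)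
  also have "\<dots> \<longleftrightarrow> eval e s = 2 ^ length p"
    using code_length[of p] pow2_unique by metis
  finally show ?thesis .
qed

lemma sat_length_less_fm:
  "eval e t = code p \<Longrightarrow> sat e (length_less_fm t c) \<longleftrightarrow> length p < c"
  by (simp add: length_less_fm_def sat_pow2_length_fm)

lemma sat_length_le_fm:
  assumes "eval e s = code q" "eval e t = code p"
  shows "sat e (length_le_fm s t d) \<longleftrightarrow> length q \<le> length p + d"
proof -
  have "(2::nat) ^ length q < Suc (2 ^ d * 2 ^ length p) \<longleftrightarrow> length q \<le> length p + d"
    by (simp add: less_Suc_eq_le power_add[symmetric] add.commute)
  then show ?thesis using assms by (simp add: length_le_fm_def sat_pow2_length_fm)
qed

lemma code_surj: "\<exists>p. code p = n"
proof (induction n rule: less_induct)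
  case (less n)
  consider "n = 0" | m where "n = 2 * m + 1" | m where "n = 2 * m + 2"
    by (metis evenE oddE Suc_1 add_2_eq_Suc' mult_0_right mult_Suc_right not0_implies_Suc add.commute)
  then show ?case
  proof cases
    case 1
    then show ?thesis by (intro exI[of _ "[]"]) simp
  next
    case 2
    then obtain p where "code p = m" using less.IH[of m] by auto
    then show ?thesis using 2 by (intro exI[of _ "False # p"]) simp
  next
    case 3
    then obtain p where "code p = m" using less.IH[of m] by auto
    then show ?thesis using 3 by (intro exI[of _ "True # p"]) simp
  qed
qed

lemma code_inj: "code p = code q \<Longrightarrow> p = q"
proof (induction p arbitrary: q)
  case Nil
  then show ?case by (cases q) (auto split: if_splits)
next
  case (Cons b p)
  then obtain b' q' where q: "q = b' # q'" by (cases q) (auto split: if_splits)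
  have "b = b' \<and> code p = code q'"
    using Cons.prems q by (auto split: if_splits; presburger)
  then show ?case using Cons.IH q by auto
qed

lemma enat_le_KC_iff: "enat c \<le> KC U x y \<longleftrightarrow> (\<forall>p. U p y = Some x \<longrightarrow> c \<le> length p)"
  by (auto simp: KC_def le_INF_iff)

lemma true_KC_ge_fm:
  assumes "natural_representation \<upsilon> U"
  shows "true_in_N (KC_ge_fm \<upsilon> x y c) \<longleftrightarrow> enat c \<le> KC U x y"
proof -
  have wf: "fwf 3 \<upsilon>"
    and U: "true_in_N (inst [num (code p), num (code y), num (code x)] \<upsilon>) \<longleftrightarrow> U p y = Some x" for p
    using assms by (auto simp: natural_representation_def)
  have *: "sat (case_nat (code p) e) (inst [Var 0, num (code y), num (code x)] \<upsilon>) \<longleftrightarrow>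
      U p y = Some x" for e p
  proof -
    have "sat (case_nat (code p) e) (inst [Var 0, num (code y), num (code x)] \<upsilon>) \<longleftrightarrow>
      sat e' (inst [num (code p), num (code y), num (code x)] \<upsilon>)" for e'
      unfolding inst_def sat_subst
      by (intro sat_cong[OF wf]) (auto simp: nth_Cons less_Suc_eq numeral_3_eq_3 split: nat.split)
    then show ?thesis using U[of p] unfolding true_in_N_def by blast
  qed
  have "true_in_N (KC_ge_fm \<upsilon> x y c) \<longleftrightarrow>
    (\<forall>e p. sat (case_nat (code p) e) (length_less_fm (Var 0) c) \<longrightarrow>
       \<not> sat (case_nat (code p) e) (inst [Var 0, num (code y), num (code x)] \<upsilon>))"
    unfolding true_in_N_def KC_ge_fm_def by (simp, metis code_surj)
  also have "\<dots> \<longleftrightarrow> (\<forall>p. U p y = Some x \<longrightarrow> c \<le> length p)"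
  proof -
    have "sat (case_nat (code p) e) (length_less_fm (Var 0) c) \<longleftrightarrow> length p < c" for p e
      by (rule sat_length_less_fm) simp
    then show ?thesis unfolding * by (auto simp: not_less)
  qed
  finally show ?thesis unfolding enat_le_KC_iff .
qed

end

theory Submission
  imports Defs "HOL-Library.Countable_Set"
begin

text \<open>Let \<open>\<theta>(t, y)\<close> be a bounded formula saying that \<open>t\<close> refutes \<open>y\<close>.  Consider the interpreter whose
  program \<open>p\<close> on condition \<open>y\<close> waits for the least \<open>t\<close> that refutes \<open>y\<close> and then outputs the first
  \<open>x\<close> for which no program of length less than \<open>c = 2|p|\<close> has been seen to map \<open>y\<close> to \<open>x\<close> by time
  \<open>t\<close>.  By optimality \<open>C(x|y) \<le> |p| + d\<close>, which is less than \<open>c\<close> once \<open>|p| > d\<close>.  If \<open>y\<close> is in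
  fact never refuted, let \<open>x\<close> be the first string with \<open>C(x|y) \<ge> c\<close>.  All smaller strings are
  seen to be simple by some standard time \<open>T\<close>, and a refutation in a model of PA can only come later;
  so in a model of \<open>C(x|y) \<ge> c\<close> it would make the interpreter output \<open>x\<close>, a contradiction.  Hence
  PA together with this single axiom proves that \<open>y\<close> is never refuted, with \<open>c\<close> depending on \<open>\<theta>\<close> only.

  Applied to a fixed true \<open>\<Pi>\<^sub>1\<close> sentence, with \<open>y\<close> a dummy, this reduces the sentence to some true
  \<open>C(x|0) \<ge> a\<close>.  Applied once more to all statements \<open>C(x|0) \<ge> a\<close> simultaneously, with \<open>y\<close> coding
  \<open>x\<close> and \<open>a\<close>, it yields a constant that does not depend on the sentence, so that no universal
  \<open>\<Sigma>\<^sub>1\<close> formula has to be constructed.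

  Provability is handled semantically, through a completeness theorem for the calculus.\<close>

section \<open>Substitution\<close>

lemma tsubst_tsubst: "tsubst \<sigma> (tsubst \<tau> t) = tsubst (\<lambda>n. tsubst \<sigma> (\<tau> n)) t"
  by (induction t) auto

lemma slift_slift: "tsubst (slift \<sigma>) (slift \<tau> n) = slift (\<lambda>n. tsubst \<sigma> (\<tau> n)) n"
  by (auto simp: slift_def tlift_def tsubst_tsubst split: nat.split)

lemma subst_subst: "subst \<sigma> (subst \<tau> \<phi>) = subst (\<lambda>n. tsubst \<sigma> (\<tau> n)) \<phi>"
  by (induction \<phi> arbitrary: \<sigma> \<tau>) (auto simp: tsubst_tsubst slift_slift[abs_def])

lemma tsubst_Var [simp]: "tsubst Var t = t"
  by (induction t) auto

lemma slift_Var [simp]: "slift Var = Var"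
  by (auto simp: slift_def tlift_def fun_eq_iff split: nat.split)

lemma subst_Var [simp]: "subst Var \<phi> = \<phi>"
  by (induction \<phi>) auto

lemma tsubst_cong: "twf n t \<Longrightarrow> (\<And>i. i < n \<Longrightarrow> \<sigma> i = \<tau> i) \<Longrightarrow> tsubst \<sigma> t = tsubst \<tau> t"
  by (induction t) auto

lemma subst_cong: "fwf n \<phi> \<Longrightarrow> (\<And>i. i < n \<Longrightarrow> \<sigma> i = \<tau> i) \<Longrightarrow> subst \<sigma> \<phi> = subst \<tau> \<phi>"
proof (induction \<phi> arbitrary: n \<sigma> \<tau>)
  case (Eq s t)
  then show ?case by (auto intro: tsubst_cong)
next
  case (Less s t)
  then show ?case by (auto intro: tsubst_cong)
next
  case (Imp \<phi> \<psi>)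
  then show ?case by (metis fwf.simps(4) subst.simps(4))
next
  case (All \<phi>)
  have "subst (slift \<sigma>) \<phi> = subst (slift \<tau>) \<phi>"
    by (rule All.IH[of "Suc n"]) (use All.prems in \<open>auto simp: slift_def split: nat.split\<close>)
  then show ?case by simp
qed simp

lemma twf_tsubst: "twf n t \<Longrightarrow> (\<And>i. i < n \<Longrightarrow> twf m (\<sigma> i)) \<Longrightarrow> twf m (tsubst \<sigma> t)"
  by (induction t) auto

lemma twf_tlift [simp]: "twf (Suc n) (tlift t) \<longleftrightarrow> twf n t"
  by (induction t) (auto simp: tlift_def)

lemma fwf_subst: "fwf n \<phi> \<Longrightarrow> (\<And>i. i < n \<Longrightarrow> twf m (\<sigma> i)) \<Longrightarrow> fwf m (subst \<sigma> \<phi>)"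
proof (induction \<phi> arbitrary: n m \<sigma>)
  case (Imp \<phi> \<psi>)
  then show ?case by (metis fwf.simps(4) subst.simps(4))
next
  case (All \<phi>)
  have "fwf (Suc m) (subst (slift \<sigma>) \<phi>)"
    by (rule All.IH[of "Suc n"]) (use All.prems in \<open>auto simp: slift_def split: nat.split\<close>)
  then show ?case by simp
qed (auto intro: twf_tsubst)

lemma twf_mono: "twf n t \<Longrightarrow> n \<le> m \<Longrightarrow> twf m t"
  by (induction t) auto

lemma fwf_mono: "fwf n \<phi> \<Longrightarrow> n \<le> m \<Longrightarrow> fwf m \<phi>"
  by (induction \<phi> arbitrary: n m) (auto intro: twf_mono)

lemma twf_exists: "\<exists>n. twf n t"
proof (induction t)
  case (Var m)
  show ?case by (rule exI[of _ "Suc m"]) simp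
next
  case (Plus s t)
  then show ?case by (metis twf.simps(4) twf_mono max.cobounded1 max.cobounded2)
next
  case (Times s t)
  then show ?case by (metis twf.simps(5) twf_mono max.cobounded1 max.cobounded2)
qed auto

lemma fwf_exists: "\<exists>n. fwf n \<phi>"
proof (induction \<phi>)
  case (Eq s t)
  show ?case using twf_exists[of s] twf_exists[of t]
    by (metis fwf.simps(1) twf_mono max.cobounded1 max.cobounded2)
next
  case (Less s t)
  show ?case using twf_exists[of s] twf_exists[of t]
    by (metis fwf.simps(2) twf_mono max.cobounded1 max.cobounded2)
next
  case (Imp \<phi> \<psi>)
  then show ?case by (metis fwf.simps(4) fwf_mono max.cobounded1 max.cobounded2)
next
  case (All \<phi>)
  then show ?case by (metis fwf.simps(5) fwf_mono le_SucI order_refl)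
qed auto

lemma twf_num [simp]: "twf k (num n)"
  by (induction n) auto

lemma inst1: "inst [t] \<phi> = subst (case_nat t Var) \<phi>"
  unfolding inst_def by (rule arg_cong[of _ _ "\<lambda>\<sigma>. subst \<sigma> \<phi>"]) (auto simp: fun_eq_iff split: nat.split)

lemma tsubst_case_nat_tlift [simp]: "tsubst (case_nat s \<sigma>) (tlift t) = tsubst \<sigma> t"
  by (simp add: tlift_def tsubst_tsubst)

text \<open>This identity is behind both the commutation of substitution with instantiation and the
  quantifier case of the truth lemma for the term model.\<close>

lemma inst1_subst_slift: "inst [t] (subst (slift \<sigma>) \<phi>) = subst (case_nat t \<sigma>) \<phi>"
  unfolding inst1 subst_subst
  by (rule arg_cong[of _ _ "\<lambda>\<sigma>. subst \<sigma> \<phi>"]) (auto simp: slift_def fun_eq_iff split: nat.split)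

lemma subst_inst1: "subst \<sigma> (inst [t] \<phi>) = inst [tsubst \<sigma> t] (subst (slift \<sigma>) \<phi>)"
  unfolding inst1_subst_slift unfolding inst1 subst_subst
  by (rule arg_cong[of _ _ "\<lambda>\<sigma>. subst \<sigma> \<phi>"]) (auto simp: fun_eq_iff split: nat.split)

lemma subst_slift_lift: "subst (slift \<sigma>) (lift \<phi>) = lift (subst \<sigma> \<phi>)"
  by (simp add: lift_def subst_subst slift_def tlift_def)

section \<open>Completeness of the calculus\<close>

lemma proves_mono: "\<Gamma> \<turnstile> \<phi> \<Longrightarrow> \<Gamma> \<subseteq> \<Delta> \<Longrightarrow> \<Delta> \<turnstile> \<phi>"
proof (induction arbitrary: \<Delta> rule: proves.induct)
  case (Assm \<phi> \<Gamma>)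
  then show ?case by (auto intro: proves.Assm)
next
  case (ImpI \<phi> \<Gamma> \<psi>)
  then show ?case by (metis insert_mono proves.ImpI)
next
  case (ImpE \<Gamma> \<phi> \<psi>)
  then show ?case by (metis proves.ImpE)
next
  case (Classical \<phi> \<Gamma>)
  then show ?case by (metis insert_mono proves.Classical)
next
  case (AllI \<Gamma> \<phi>)
  then show ?case by (metis image_mono proves.AllI)
next
  case (AllE \<Gamma> \<phi> t)
  then show ?case by (metis proves.AllE)
next
  case (Refl \<Gamma> t)
  show ?case by (rule proves.Refl)
next
  case (EqE \<Gamma> s t \<phi>)
  then show ?case by (metis proves.EqE)
qed

text \<open>Needed for the consistency of the union of a chain. In the discharging rules, the
  discharged formula is removed from the finite set and restored by monotonicity.\<close>

lemma proves_finite: "\<Gamma> \<turnstile> \<phi> \<Longrightarrow> \<exists>\<Delta>. finite \<Delta> \<and> \<Delta> \<subseteq> \<Gamma> \<and> \<Delta> \<turnstile> \<phi>"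
proof (induction rule: proves.induct)
  case (Assm \<phi> \<Gamma>)
  then show ?case by (intro exI[of _ "{\<phi>}"]) (auto intro: proves.Assm)
next
  case (ImpI \<phi> \<Gamma> \<psi>)
  then obtain \<Delta> where \<Delta>: "finite \<Delta>" "\<Delta> \<subseteq> insert \<phi> \<Gamma>" "\<Delta> \<turnstile> \<psi>" by blast
  have "\<Delta> - {\<phi>} \<turnstile> Imp \<phi> \<psi>" by (rule proves.ImpI, rule proves_mono[OF \<Delta>(3)]) auto
  then show ?case using \<Delta> by (intro exI[of _ "\<Delta> - {\<phi>}"]) auto
next
  case (ImpE \<Gamma> \<phi> \<psi>)
  then obtain \<Delta> \<Delta>' where \<Delta>: "finite \<Delta>" "\<Delta> \<subseteq> \<Gamma>" "\<Delta> \<turnstile> Imp \<phi> \<psi>"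
      "finite \<Delta>'" "\<Delta>' \<subseteq> \<Gamma>" "\<Delta>' \<turnstile> \<phi>"
    by blast
  have "\<Delta> \<union> \<Delta>' \<turnstile> \<psi>"
    by (rule proves.ImpE[of _ \<phi>]; rule proves_mono[OF \<Delta>(3)] proves_mono[OF \<Delta>(6)]; blast)
  then show ?case using \<Delta> by (intro exI[of _ "\<Delta> \<union> \<Delta>'"]) auto
next
  case (Classical \<phi> \<Gamma>)
  then obtain \<Delta> where \<Delta>: "finite \<Delta>" "\<Delta> \<subseteq> insert (Neg \<phi>) \<Gamma>" "\<Delta> \<turnstile> Falsum" by blast
  have "\<Delta> - {Neg \<phi>} \<turnstile> \<phi>" by (rule proves.Classical, rule proves_mono[OF \<Delta>(3)]) auto
  then show ?case using \<Delta> by (intro exI[of _ "\<Delta> - {Neg \<phi>}"]) auto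
next
  case (AllI \<Gamma> \<phi>)
  then obtain \<Delta> where "finite \<Delta>" "\<Delta> \<subseteq> lift ` \<Gamma>" "\<Delta> \<turnstile> \<phi>" by blast
  then show ?case by (metis finite_subset_image proves.AllI)
next
  case (AllE \<Gamma> \<phi> t)
  then show ?case by (blast intro: proves.AllE)
next
  case (Refl \<Gamma> t)
  show ?case by (intro exI[of _ "{}"]) (auto intro: proves.Refl)
next
  case (EqE \<Gamma> s t \<phi>)
  then obtain \<Delta> \<Delta>' where \<Delta>: "finite \<Delta>" "\<Delta> \<subseteq> \<Gamma>" "\<Delta> \<turnstile> Eq s t"
      "finite \<Delta>'" "\<Delta>' \<subseteq> \<Gamma>" "\<Delta>' \<turnstile> inst [s] \<phi>"
    by blast
  have "\<Delta> \<union> \<Delta>' \<turnstile> inst [t] \<phi>"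
    by (rule proves.EqE[of _ s]; rule proves_mono[OF \<Delta>(3)] proves_mono[OF \<Delta>(6)]; blast)
  then show ?case using \<Delta> by (intro exI[of _ "\<Delta> \<union> \<Delta>'"]) auto
qed

text \<open>\<open>AllI\<close> lifts the whole context instead of asking for a fresh variable.
  Closure under substitution bridges the two when a fresh variable is to be generalized.\<close>

lemma proves_subst: "\<Gamma> \<turnstile> \<phi> \<Longrightarrow> subst \<sigma> ` \<Gamma> \<turnstile> subst \<sigma> \<phi>"
proof (induction arbitrary: \<sigma> rule: proves.induct)
  case (ImpI \<phi> \<Gamma> \<psi>)
  then show ?case by (metis image_insert proves.ImpI subst.simps(4))
next
  case (ImpE \<Gamma> \<phi> \<psi>)
  then show ?case by (metis proves.ImpE subst.simps(4))
next
  case (Classical \<phi> \<Gamma>)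
  from Classical.IH[of \<sigma>] show ?case by (simp add: proves.Classical)
next
  case (AllI \<Gamma> \<phi>)
  from AllI.IH[of "slift \<sigma>"] show ?case
    by (simp add: image_image subst_slift_lift proves.AllI)
next
  case (AllE \<Gamma> \<phi> t)
  then show ?case by (metis proves.AllE subst.simps(5) subst_inst1)
next
  case (EqE \<Gamma> s t \<phi>)
  then show ?case by (metis proves.EqE subst.simps(1) subst_inst1)
qed (simp_all add: proves.Assm proves.Refl)

text \<open>The variable \<open>n\<close> is fresh, so it can be renamed to the bound variable.\<close>

lemma proves_generalize:
  assumes "\<Gamma> \<turnstile> inst [Var n] \<phi>" "\<forall>\<chi>\<in>\<Gamma>. fwf n \<chi>" "fwf (Suc n) \<phi>"
  shows "\<Gamma> \<turnstile> All \<phi>"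
proof -
  define \<sigma> where "\<sigma> i = (if i = n then Var 0 else Var (Suc i))" for i
  have "subst \<sigma> \<chi> = lift \<chi>" if "\<chi> \<in> \<Gamma>" for \<chi>
    unfolding lift_def using that assms(2) by (intro subst_cong[of n]) (auto simp: \<sigma>_def)
  then have 1: "subst \<sigma> ` \<Gamma> = lift ` \<Gamma>" by (intro image_cong) auto
  have "subst \<sigma> (inst [Var n] \<phi>) = subst Var \<phi>"
    unfolding inst1 subst_subst
    by (rule subst_cong[OF assms(3)]) (auto simp: \<sigma>_def split: nat.split)
  then show ?thesis using proves_subst[OF assms(1), of \<sigma>] 1 by (simp add: proves.AllI)
qed

section \<open>Henkin extensions of consistent sets of sentences\<close>

definition consistent :: "fm set \<Rightarrow> bool" where
  "consistent \<Gamma> \<longleftrightarrow> \<not> \<Gamma> \<turnstile> Falsum"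

lemma consistent_insert_Neg: "\<not> consistent (insert (Neg \<phi>) \<Gamma>) \<Longrightarrow> \<Gamma> \<turnstile> \<phi>"
  using Classical by (simp add: consistent_def)

lemma consistent_insert: "\<not> consistent (insert \<phi> \<Gamma>) \<Longrightarrow> \<Gamma> \<turnstile> Neg \<phi>"
  using ImpI by (simp add: consistent_def)

text \<open>A fresh variable serves as the Henkin witness, and the bound on the free variables is
  kept as an invariant to supply one at every stage. If \<open>Neg (inst [Var n] \<psi>)\<close>
  could not be added, generalization would prove the rejected \<open>All \<psi>\<close>.\<close>

lemma henkin_step:
  assumes "consistent \<Gamma>" and "\<exists>n. \<forall>\<chi>\<in>\<Gamma>. fwf n \<chi>"
  shows "\<exists>\<Gamma>'. (consistent \<Gamma>' \<and> (\<exists>n. \<forall>\<chi>\<in>\<Gamma>'. fwf n \<chi>)) \<and> \<Gamma> \<subseteq> \<Gamma>' \<and> (\<phi> \<in> \<Gamma>' \<or> Neg \<phi> \<in> \<Gamma>') \<and>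
    (\<forall>\<psi>. \<phi> = All \<psi> \<longrightarrow> \<phi> \<in> \<Gamma>' \<or> (\<exists>t. Neg (inst [t] \<psi>) \<in> \<Gamma>'))"
proof -
  obtain n where n: "\<forall>\<chi>\<in>\<Gamma>. fwf n \<chi>" "fwf n \<phi>"
    using assms(2) fwf_exists[of \<phi>] by (metis fwf_mono max.cobounded1 max.cobounded2)
  show ?thesis
  proof (cases "consistent (insert \<phi> \<Gamma>)")
    case True
    then show ?thesis using n by (intro exI[of _ "insert \<phi> \<Gamma>"]) auto
  next
    case False
    then have neg: "\<Gamma> \<turnstile> Neg \<phi>" by (rule consistent_insert)
    have con: "consistent (insert (Neg \<phi>) \<Gamma>)"
      using neg assms(1) consistent_insert_Neg proves.ImpE by (metis consistent_def)
    show ?thesis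
    proof (cases "\<exists>\<psi>. \<phi> = All \<psi>")
      case True
      then obtain \<psi> where \<psi>: "\<phi> = All \<psi>" by blast
      let ?G = "insert (Neg \<phi>) \<Gamma>"
      have "consistent (insert (Neg (inst [Var n] \<psi>)) ?G)"
      proof (rule ccontr)
        assume "\<not> ?thesis"
        then have "?G \<turnstile> inst [Var n] \<psi>" by (rule consistent_insert_Neg)
        then have "?G \<turnstile> \<phi>" unfolding \<psi> by (rule proves_generalize) (use n \<psi> in auto)
        moreover have "?G \<turnstile> Neg \<phi>" by (rule proves.Assm) simp
        ultimately show False using con proves.ImpE by (metis consistent_def)
      qed
      moreover have "fwf (Suc n) (inst [Var n] \<psi>)"
        unfolding inst1 using n \<psi> by (intro fwf_subst[of "Suc n"]) (auto split: nat.split)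
      ultimately show ?thesis using n \<psi>
        by (intro exI[of _ "insert (Neg (inst [Var n] \<psi>)) ?G"])
          (auto intro!: exI[of _ "Suc n"] intro: fwf_mono[of n] fwf_mono[of "Suc n"])
    next
      case False
      then show ?thesis using n con by (intro exI[of _ "insert (Neg \<phi>) \<Gamma>"]) auto
    qed
  qed
qed

instance tm :: countable by countable_datatype
instance fm :: countable by countable_datatype

text \<open>All formulas are enumerated and decided one after another. The union of the stages is
  consistent because a derivation of \<open>Falsum\<close> uses finitely many assumptions, all
  present at some stage.\<close>

lemma henkin_extension:
  assumes "consistent \<Gamma>" "\<forall>\<chi>\<in>\<Gamma>. sentence \<chi>"
  shows "\<exists>H. \<Gamma> \<subseteq> H \<and> consistent H \<and> (\<forall>\<phi>. \<phi> \<in> H \<or> Neg \<phi> \<in> H) \<and>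
    (\<forall>\<psi>. All \<psi> \<in> H \<or> (\<exists>t. Neg (inst [t] \<psi>) \<in> H))"
proof -
  define good where "good \<Delta> \<longleftrightarrow> consistent \<Delta> \<and> (\<exists>n. \<forall>\<chi>\<in>\<Delta>. fwf n \<chi>)" for \<Delta>
  define ext where "ext n \<Delta> \<Delta>' \<longleftrightarrow> \<Delta> \<subseteq> \<Delta>' \<and> (from_nat n \<in> \<Delta>' \<or> Neg (from_nat n) \<in> \<Delta>') \<and>
    (\<forall>\<psi>. from_nat n = All \<psi> \<longrightarrow> from_nat n \<in> \<Delta>' \<or> (\<exists>t. Neg (inst [t] \<psi>) \<in> \<Delta>'))" for n \<Delta> \<Delta>'
  have "\<exists>f. f 0 = \<Gamma> \<and> (\<forall>n. good (f n) \<and> ext n (f n) (f (Suc n)))"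
  proof -
    have "\<exists>\<Delta>'. good \<Delta>' \<and> ext n \<Delta> \<Delta>'" if "good \<Delta>" for \<Delta> n
      using henkin_step[of \<Delta> "from_nat n"] that unfolding good_def ext_def by blast
    moreover have "good \<Gamma>" using assms good_def by blast
    \<comment> \<open>The clause for \<open>n = 0\<close> pins the start of the chain to
      \<open>\<Gamma>\<close>, which dependent choice alone leaves open.\<close>
    ultimately have "\<exists>f. \<forall>n. (good (f n) \<and> (n = 0 \<longrightarrow> f n = \<Gamma>)) \<and> ext n (f n) (f (Suc n))"
      by (intro dependent_nat_choice[where P = "\<lambda>n \<Delta>. good \<Delta> \<and> (n = 0 \<longrightarrow> \<Delta> = \<Gamma>)" and Q = ext]) auto
    then show ?thesis by metis
  qed
  then obtain f where f: "f 0 = \<Gamma>" "\<And>n. good (f n)" "\<And>n. ext n (f n) (f (Suc n))" by blast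
  have mono: "f m \<subseteq> f n" if "m \<le> n" for m n
    by (rule lift_Suc_mono_le[OF _ that]) (use f(3) in \<open>auto simp: ext_def\<close>)
  define H where "H = (\<Union>n. f n)"
  have "consistent H"
    unfolding consistent_def
  proof
    assume "H \<turnstile> Falsum"
    then obtain \<Delta> where \<Delta>: "finite \<Delta>" "\<Delta> \<subseteq> H" "\<Delta> \<turnstile> Falsum" using proves_finite by blast
    have "\<exists>n. \<Delta> \<subseteq> f n" using \<Delta>(1,2)
    proof (induction \<Delta>)
      case (insert \<phi> \<Delta>)
      then obtain m n where "\<phi> \<in> f m" "\<Delta> \<subseteq> f n" unfolding H_def by blast
      then have "insert \<phi> \<Delta> \<subseteq> f (max m n)"
        using mono[of m "max m n"] mono[of n "max m n"] by auto
      then show ?case ..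
    qed simp
    then show False using \<Delta>(3) f(2) proves_mono unfolding good_def consistent_def by blast
  qed
  moreover have "\<phi> \<in> H \<or> Neg \<phi> \<in> H" for \<phi>
    using f(3)[of "to_nat \<phi>"] unfolding H_def ext_def from_nat_to_nat by blast
  moreover have "All \<psi> \<in> H \<or> (\<exists>t. Neg (inst [t] \<psi>) \<in> H)" for \<psi>
    using f(3)[of "to_nat (All \<psi>)"] unfolding H_def ext_def from_nat_to_nat by blast
  moreover have "\<Gamma> \<subseteq> H" using f(1) unfolding H_def by blast
  ultimately show ?thesis by blast
qed

section \<open>Structures for the language of arithmetic\<close>

record 'a arith =
  zero :: 'a
  suc :: "'a \<Rightarrow> 'a"
  plus :: "'a \<Rightarrow> 'a \<Rightarrow> 'a"
  times :: "'a \<Rightarrow> 'a \<Rightarrow> 'a"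
  less :: "'a \<Rightarrow> 'a \<Rightarrow> bool"

primrec meval :: "'a arith \<Rightarrow> (nat \<Rightarrow> 'a) \<Rightarrow> tm \<Rightarrow> 'a" where
  "meval M e (Var n) = e n"
| "meval M e Zero = zero M"
| "meval M e (Succ t) = suc M (meval M e t)"
| "meval M e (Plus s t) = plus M (meval M e s) (meval M e t)"
| "meval M e (Times s t) = times M (meval M e s) (meval M e t)"

text \<open>The clauses are those of \<open>sat\<close>, but over an arbitrary structure, because
  the argument takes place in nonstandard models.\<close>

primrec msat :: "'a arith \<Rightarrow> (nat \<Rightarrow> 'a) \<Rightarrow> fm \<Rightarrow> bool" where
  "msat M e (Eq s t) \<longleftrightarrow> meval M e s = meval M e t"
| "msat M e (Less s t) \<longleftrightarrow> less M (meval M e s) (meval M e t)"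
| "msat M e Falsum \<longleftrightarrow> False"
| "msat M e (Imp \<phi> \<psi>) \<longleftrightarrow> (msat M e \<phi> \<longrightarrow> msat M e \<psi>)"
| "msat M e (All \<phi>) \<longleftrightarrow> (\<forall>a. msat M (case_nat a e) \<phi>)"

lemma meval_tsubst: "meval M e (tsubst \<sigma> t) = meval M (\<lambda>n. meval M e (\<sigma> n)) t"
  by (induction t) auto

lemma meval_tlift [simp]: "meval M (case_nat a e) (tlift t) = meval M e t"
  by (simp add: tlift_def meval_tsubst)

lemma msat_subst: "msat M e (subst \<sigma> \<phi>) \<longleftrightarrow> msat M (\<lambda>n. meval M e (\<sigma> n)) \<phi>"
proof (induction \<phi> arbitrary: e \<sigma>)
  case (All \<phi>)
  have "(\<lambda>n. meval M (case_nat a e) (slift \<sigma> n)) = case_nat a (\<lambda>n. meval M e (\<sigma> n))" for a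
    by (auto simp: slift_def fun_eq_iff split: nat.split)
  then show ?case using All by simp
qed (auto simp: meval_tsubst)

lemma msat_lift [simp]: "msat M (case_nat a e) (lift \<phi>) = msat M e \<phi>"
  by (simp add: lift_def msat_subst)

lemma msat_inst1: "msat M e (inst [t] \<phi>) \<longleftrightarrow> msat M (case_nat (meval M e t) e) \<phi>"
proof -
  have "(\<lambda>n. meval M e (case_nat t Var n)) = case_nat (meval M e t) e"
    by (auto simp: fun_eq_iff split: nat.split)
  then show ?thesis by (simp add: inst1 msat_subst)
qed

lemma proves_msat: "\<Gamma> \<turnstile> \<phi> \<Longrightarrow> (\<forall>\<psi>\<in>\<Gamma>. msat M e \<psi>) \<Longrightarrow> msat M e \<phi>"
  by (induction arbitrary: e rule: proves.induct) (auto simp: msat_inst1)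

lemma meval_cong: "twf k t \<Longrightarrow> (\<And>n. n < k \<Longrightarrow> e n = e' n) \<Longrightarrow> meval M e t = meval M e' t"
  by (induction t) auto

lemma msat_cong: "fwf k \<phi> \<Longrightarrow> (\<And>n. n < k \<Longrightarrow> e n = e' n) \<Longrightarrow> msat M e \<phi> = msat M e' \<phi>"
proof (induction \<phi> arbitrary: k e e')
  case (All \<phi>)
  have "msat M (case_nat a e) \<phi> = msat M (case_nat a e') \<phi>" for a
    using All.prems by (intro All.IH[of "Suc k"]) (auto split: nat.split)
  then show ?case by simp
next
  case (Imp \<phi> \<psi>)
  have "msat M e \<phi> = msat M e' \<phi>" "msat M e \<psi> = msat M e' \<psi>"
    using Imp.prems by (auto intro!: Imp.IH(1)[of k] Imp.IH(2)[of k])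
  then show ?case by simp
next
  case (Eq s t)
  then show ?case using meval_cong[of k s e e'] meval_cong[of k t e e'] by simp
next
  case (Less s t)
  then show ?case using meval_cong[of k s e e'] meval_cong[of k t e e'] by simp
qed auto

lemma msat_sentence: "sentence \<phi> \<Longrightarrow> msat M e \<phi> = msat M e' \<phi>"
  by (rule msat_cong) auto

section \<open>The term model of a Henkin set\<close>

locale henkin =
  fixes H :: "fm set"
  assumes consistent: "consistent H"
    and complete: "\<phi> \<in> H \<or> Neg \<phi> \<in> H"
    and witness: "All \<psi> \<in> H \<or> (\<exists>t. Neg (inst [t] \<psi>) \<in> H)"
    and Robinson: "Robinson \<subseteq> H"
begin

lemma closed: "H \<turnstile> \<phi> \<longleftrightarrow> \<phi> \<in> H"
  using consistent complete[of \<phi>] unfolding consistent_def by (metis ImpE Assm)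

lemma Falsum: "Falsum \<notin> H"
  using consistent closed by (simp add: consistent_def)

lemma Imp_iff: "Imp \<phi> \<psi> \<in> H \<longleftrightarrow> (\<phi> \<in> H \<longrightarrow> \<psi> \<in> H)"
proof
  show "Imp \<phi> \<psi> \<in> H \<Longrightarrow> \<phi> \<in> H \<longrightarrow> \<psi> \<in> H" using closed ImpE by metis
next
  assume *: "\<phi> \<in> H \<longrightarrow> \<psi> \<in> H"
  have "insert \<phi> H \<turnstile> \<psi>"
  proof (cases "\<phi> \<in> H")
    case True
    then show ?thesis using * by (auto intro: Assm)
  next
    case False
    then have "Neg \<phi> \<in> H" using complete by blast
    then have "insert (Neg \<psi>) (insert \<phi> H) \<turnstile> Falsum"
      by (intro ImpE[of _ \<phi> Falsum]; intro Assm) simp_all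
    then show ?thesis by (rule Classical)
  qed
  then show "Imp \<phi> \<psi> \<in> H" using closed ImpI by metis
qed

lemma All_iff: "All \<phi> \<in> H \<longleftrightarrow> (\<forall>t. inst [t] \<phi> \<in> H)"
  using witness[of \<phi>] closed AllE Imp_iff Falsum by metis

lemma Eq_refl: "Eq t t \<in> H"
  using closed Refl by blast

lemma Eq_subst: "Eq s t \<in> H \<Longrightarrow> inst [s] \<phi> \<in> H \<Longrightarrow> inst [t] \<phi> \<in> H"
  using closed EqE by metis

lemma Eq_sym: "Eq s t \<in> H \<Longrightarrow> Eq t s \<in> H"
  using Eq_subst[of s t "Eq (Var 0) (tlift s)"] by (simp add: inst1 Eq_refl)

lemma Eq_trans: "Eq s t \<in> H \<Longrightarrow> Eq t u \<in> H \<Longrightarrow> Eq s u \<in> H"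
  using Eq_subst[of t u "Eq (tlift s) (Var 0)"] by (simp add: inst1)

lemma Eq_Succ: "Eq s t \<in> H \<Longrightarrow> Eq (Succ s) (Succ t) \<in> H"
  using Eq_subst[of s t "Eq (Succ (tlift s)) (Succ (Var 0))"] by (simp add: inst1 Eq_refl)

lemma Eq_Plus: "Eq s t \<in> H \<Longrightarrow> Eq s' t' \<in> H \<Longrightarrow> Eq (Plus s s') (Plus t t') \<in> H"
  using Eq_subst[of s t "Eq (tlift (Plus s s')) (Plus (Var 0) (tlift s'))"]
    Eq_subst[of s' t' "Eq (tlift (Plus s s')) (Plus (tlift t) (Var 0))"]
  by (simp add: inst1 Eq_refl)

lemma Eq_Times: "Eq s t \<in> H \<Longrightarrow> Eq s' t' \<in> H \<Longrightarrow> Eq (Times s s') (Times t t') \<in> H"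
  using Eq_subst[of s t "Eq (tlift (Times s s')) (Times (Var 0) (tlift s'))"]
    Eq_subst[of s' t' "Eq (tlift (Times s s')) (Times (tlift t) (Var 0))"]
  by (simp add: inst1 Eq_refl)

lemma Less_Eq: "Eq s t \<in> H \<Longrightarrow> Eq s' t' \<in> H \<Longrightarrow> Less s s' \<in> H \<Longrightarrow> Less t t' \<in> H"
  using Eq_subst[of s t "Less (Var 0) (tlift s')"] Eq_subst[of s' t' "Less (tlift t) (Var 0)"]
  by (simp add: inst1)

lemma not_Eq_Succ_Zero: "Eq (Succ t) Zero \<notin> H"
proof -
  have "All (Neg (Eq (Succ (Var 0)) Zero)) \<in> H" using Robinson by (auto simp: Robinson_def)
  then have "inst [t] (Neg (Eq (Succ (Var 0)) Zero)) \<in> H" unfolding All_iff by blast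
  then show ?thesis by (simp add: inst1 Imp_iff Falsum)
qed

lemma Eq_SuccD: "Eq (Succ s) (Succ t) \<in> H \<Longrightarrow> Eq s t \<in> H"
proof -
  have "All (All (Imp (Eq (Succ (Var 1)) (Succ (Var 0))) (Eq (Var 1) (Var 0)))) \<in> H"
    using Robinson by (auto simp: Robinson_def)
  then have "inst [s] (All (Imp (Eq (Succ (Var 1)) (Succ (Var 0))) (Eq (Var 1) (Var 0)))) \<in> H"
    unfolding All_iff[of "All _"] by blast
  then show "Eq (Succ s) (Succ t) \<in> H \<Longrightarrow> Eq s t \<in> H"
    by (simp add: inst1 Imp_iff slift_def All_iff)
qed

lemma Eq_num: "Eq (num m) (num n) \<in> H \<Longrightarrow> m = n"
proof (induction m arbitrary: n)
  case 0
  then show ?case using not_Eq_Succ_Zero Eq_sym by (cases n) auto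
next
  case (Suc m)
  then show ?case using not_Eq_Succ_Zero Eq_SuccD by (cases n) auto
qed

text \<open>The Robinson axioms separate the numerals, so there are infinitely many classes of
  provably equal terms. Being countable, they can be numbered by all of \<open>nat\<close>, which
  becomes the carrier of the model.\<close>

lemma class_numbering: "\<exists>g :: tm \<Rightarrow> nat. surj g \<and> (\<forall>s t. g s = g t \<longleftrightarrow> Eq s t \<in> H)"
proof -
  define cls where "cls t = {s. Eq t s \<in> H}" for t
  have cls: "cls s = cls t \<longleftrightarrow> Eq s t \<in> H" for s t
    unfolding cls_def using Eq_sym Eq_trans Eq_refl by blast
  have "inj (\<lambda>n. cls (num n))" by (rule injI) (simp add: cls Eq_num)
  then have "infinite (range (\<lambda>n. cls (num n)))" by (rule range_inj_infinite)
  then have "infinite (range cls)" by (rule contrapos_nn) (auto elim: finite_subset[rotated])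
  then have "bij_betw (to_nat_on (range cls)) (range cls) UNIV"
    by (intro to_nat_on_infinite) auto
  then have bij: "inj_on (to_nat_on (range cls)) (range cls)" "to_nat_on (range cls) ` range cls = UNIV"
    by (auto simp: bij_betw_def)
  have "to_nat_on (range cls) (cls s) = to_nat_on (range cls) (cls t) \<longleftrightarrow> Eq s t \<in> H" for s t
    using inj_on_eq_iff[OF bij(1) rangeI rangeI, of s t] cls by blast
  then show ?thesis using bij(2)
    by (intro exI[of _ "\<lambda>t. to_nat_on (range cls) (cls t)"]) (simp only: image_image, blast)
qed

lemma model: "\<exists>M :: nat arith. \<exists>e. \<forall>\<phi>. msat M e \<phi> \<longleftrightarrow> \<phi> \<in> H"
proof -
  obtain g :: "tm \<Rightarrow> nat" where g: "surj g" "\<And>s t. g s = g t \<longleftrightarrow> Eq s t \<in> H"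
    using class_numbering by blast
  define r where "r = inv g"
  have r: "g (r a) = a" for a unfolding r_def using g(1) by (rule surj_f_inv_f)
  have rg: "Eq (r (g t)) t \<in> H" for t by (simp add: g(2)[symmetric] r)
  define M where "M = \<lparr>zero = g Zero, suc = (\<lambda>a. g (Succ (r a))),
    plus = (\<lambda>a b. g (Plus (r a) (r b))), times = (\<lambda>a b. g (Times (r a) (r b))),
    less = (\<lambda>a b. Less (r a) (r b) \<in> H)\<rparr>"
  have ev: "meval M (\<lambda>n. g (\<sigma> n)) t = g (tsubst \<sigma> t)" for \<sigma> t
    by (induction t) (auto simp: M_def g(2) intro!: Eq_Succ Eq_Plus Eq_Times rg)
  have less: "Less (r (g s)) (r (g t)) \<in> H \<longleftrightarrow> Less s t \<in> H" for s t
    using Less_Eq rg Eq_sym by blast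
  \<comment> \<open>The truth lemma is stated for all substitutions so that the quantifier case can
    extend \<open>\<sigma>\<close> by a term; \<open>Var\<close> gives the result.\<close>
  have "msat M (\<lambda>n. g (\<sigma> n)) \<phi> \<longleftrightarrow> subst \<sigma> \<phi> \<in> H" for \<sigma> \<phi>
  proof (induction \<phi> arbitrary: \<sigma>)
    case (Less s t)
    show ?case by (simp add: ev) (simp add: M_def less)
  next
    case (All \<phi>)
    have "case_nat (g t) (\<lambda>n. g (\<sigma> n)) = (\<lambda>n. g (case_nat t \<sigma> n))" for t
      by (auto simp: fun_eq_iff split: nat.split)
    then have "msat M (case_nat (g t) (\<lambda>n. g (\<sigma> n))) \<phi> \<longleftrightarrow> inst [t] (subst (slift \<sigma>) \<phi>) \<in> H" for t
      by (simp add: All.IH inst1_subst_slift)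
    moreover have "(\<forall>a. P a) \<longleftrightarrow> (\<forall>t. P (g t))" for P using r by metis
    ultimately show ?case by (simp add: All_iff)
  qed (auto simp: ev g(2) Falsum Imp_iff)
  from this[of Var] show ?thesis by auto
qed

end

text \<open>This replaces formal derivations in PA by reasoning in models. Models with carrier
  \<open>nat\<close> suffice, which is why later statements quantify over
  \<open>nat arith\<close>.\<close>

theorem completeness:
  assumes "Robinson \<subseteq> \<Gamma>" "\<forall>\<chi>\<in>\<Gamma>. sentence \<chi>" "sentence \<phi>"
    and valid: "\<And>(M :: nat arith) e. \<forall>\<chi>\<in>\<Gamma>. msat M e \<chi> \<Longrightarrow> msat M e \<phi>"
  shows "\<Gamma> \<turnstile> \<phi>"
proof (rule ccontr)
  assume "\<not> \<Gamma> \<turnstile> \<phi>"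
  then have "consistent (insert (Neg \<phi>) \<Gamma>)" using consistent_insert_Neg by blast
  then obtain H where H: "insert (Neg \<phi>) \<Gamma> \<subseteq> H" "consistent H" "\<forall>\<phi>. \<phi> \<in> H \<or> Neg \<phi> \<in> H"
      "\<forall>\<psi>. All \<psi> \<in> H \<or> (\<exists>t. Neg (inst [t] \<psi>) \<in> H)"
    using henkin_extension[of "insert (Neg \<phi>) \<Gamma>"] assms(2,3) by auto
  interpret henkin H using H assms(1) by unfold_locales auto
  obtain M :: "nat arith" and e where M: "\<And>\<phi>. msat M e \<phi> \<longleftrightarrow> \<phi> \<in> H" using model by blast
  have "msat M e \<phi>" using M H(1) by (intro valid) auto
  moreover have "msat M e (Neg \<phi>)" using M H(1) by blast
  ultimately show False by simp
qed

section \<open>Models of Peano arithmetic\<close>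

primrec lenv :: "'a list \<Rightarrow> (nat \<Rightarrow> 'a) \<Rightarrow> nat \<Rightarrow> 'a" where
  "lenv [] e = e"
| "lenv (x # xs) e = case_nat x (lenv xs e)"

lemma lenv_nth: "n < length xs \<Longrightarrow> lenv xs e n = xs ! n"
  by (induction xs arbitrary: n) (auto split: nat.split)

lemma lenv_ge: "length xs \<le> n \<Longrightarrow> lenv xs e n = e (n - length xs)"
  by (induction xs arbitrary: n) (auto split: nat.split)

text \<open>Variables beyond the list default to zero; by \<open>msat_eq_rel\<close> the default
  does not matter when all free variables are covered by the list.\<close>

definition rel :: "'a arith \<Rightarrow> fm \<Rightarrow> 'a list \<Rightarrow> bool" where
  "rel M \<phi> xs \<longleftrightarrow> msat M (lenv xs (\<lambda>_. zero M)) \<phi>"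

abbreviation rev_tm :: "'a arith \<Rightarrow> tm \<Rightarrow> 'a list \<Rightarrow> 'a" where
  "rev_tm M t xs \<equiv> meval M (lenv xs (\<lambda>_. zero M)) t"

lemma rel_simps [simp]:
  "rel M (Eq s t) xs \<longleftrightarrow> rev_tm M s xs = rev_tm M t xs"
  "rel M (Less s t) xs \<longleftrightarrow> less M (rev_tm M s xs) (rev_tm M t xs)"
  "rel M Falsum xs \<longleftrightarrow> False"
  "rel M (Imp \<phi> \<psi>) xs \<longleftrightarrow> (rel M \<phi> xs \<longrightarrow> rel M \<psi> xs)"
  "rel M (All \<phi>) xs \<longleftrightarrow> (\<forall>a. rel M \<phi> (a # xs))"
  by (simp_all add: rel_def)

lemma msat_eq_rel: "fwf (length xs) \<phi> \<Longrightarrow> msat M (lenv xs e) \<phi> \<longleftrightarrow> rel M \<phi> xs"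
  unfolding rel_def by (rule msat_cong) (auto simp: lenv_nth)

lemma rel_sentence: "sentence \<phi> \<Longrightarrow> msat M e \<phi> \<longleftrightarrow> rel M \<phi> []"
  using msat_eq_rel[of "[]"] by simp

lemma msat_inst: "msat M e (inst ts \<phi>) \<longleftrightarrow> msat M (lenv (map (meval M e) ts) e) \<phi>"
proof -
  have "(\<lambda>n. meval M e (if n < length ts then ts ! n else Var (n - length ts))) =
      lenv (map (meval M e) ts) e"
    by (auto simp: fun_eq_iff lenv_nth lenv_ge)
  then show ?thesis by (simp add: inst_def msat_subst)
qed

lemma rel_inst:
  "fwf (length ts) \<phi> \<Longrightarrow> rel M (inst ts \<phi>) xs \<longleftrightarrow> rel M \<phi> (map (\<lambda>t. rev_tm M t xs) ts)"
  using msat_eq_rel[of "map (\<lambda>t. rev_tm M t xs) ts" \<phi> M]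
  by (simp add: rel_def[of M "inst ts \<phi>"] msat_inst)

lemma fwf_inst: "fwf (length ts) \<phi> \<Longrightarrow> \<forall>t\<in>set ts. twf n t \<Longrightarrow> fwf n (inst ts \<phi>)"
  unfolding inst_def by (rule fwf_subst[of "length ts"]) auto

lemma Delta0_subst: "Delta0 \<phi> \<Longrightarrow> Delta0 (subst \<sigma> \<phi>)"
proof (induction arbitrary: \<sigma> rule: Delta0.induct)
  case (5 \<phi> t)
  have "tsubst (slift \<sigma>) (tlift t) = tlift (tsubst \<sigma> t)"
    by (simp add: tlift_def tsubst_tsubst slift_def)
  moreover have "slift \<sigma> 0 = Var 0" by (simp add: slift_def)
  ultimately show ?case using Delta0.intros(5)[OF 5(2)[of "slift \<sigma>"], of "tsubst \<sigma> t"] by simp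
qed (auto intro: Delta0.intros)

lemma Delta0_inst: "Delta0 \<phi> \<Longrightarrow> Delta0 (inst ts \<phi>)"
  unfolding inst_def by (rule Delta0_subst)

primrec mnum :: "'a arith \<Rightarrow> nat \<Rightarrow> 'a" where
  "mnum M 0 = zero M"
| "mnum M (Suc n) = suc M (mnum M n)"

lemma meval_num [simp]: "meval M e (num n) = mnum M n"
  by (induction n) auto

lemma fwf_All_pow: "fwf (k + n) \<phi> \<Longrightarrow> fwf k ((All ^^ n) \<phi>)"
  by (induction n arbitrary: k) auto

lemma msat_All_powD: "(\<And>e. msat M e ((All ^^ n) \<phi>)) \<Longrightarrow> msat M e \<phi>"
proof (induction n arbitrary: e)
  case (Suc n)
  have "msat M e' ((All ^^ n) \<phi>)" for e'
  proof -
    have "msat M (case_nat (e' 0) (\<lambda>n. e' (Suc n))) ((All ^^ n) \<phi>)"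
      using Suc.prems[of "\<lambda>n. e' (Suc n)"] by simp
    moreover have "case_nat (e' 0) (\<lambda>n. e' (Suc n)) = e'"
      by (auto simp: fun_eq_iff split: nat.split)
    ultimately show ?thesis by simp
  qed
  then show ?case by (rule Suc.IH)
qed simp

section \<open>Order, least elements and standard numbers in a model of PA\<close>

locale PA_model =
  fixes M :: "'a arith"
  assumes PA: "\<phi> \<in> PA \<Longrightarrow> msat M e \<phi>"
begin

text \<open>PA contains induction only in universally closed form, so enough quantifiers are
  prefixed to close the formula and are then stripped again.\<close>

lemma induct:
  assumes "msat M (case_nat (zero M) e) \<phi>"
    and "\<And>a. msat M (case_nat a e) \<phi> \<Longrightarrow> msat M (case_nat (suc M a) e) \<phi>"
  shows "msat M (case_nat a e) \<phi>"
proof -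
  obtain n where "fwf n (induction_fm \<phi>)" using fwf_exists by blast
  then have "sentence ((All ^^ n) (induction_fm \<phi>))" by (intro fwf_All_pow) simp
  then have "(All ^^ n) (induction_fm \<phi>) \<in> PA" unfolding PA_def by blast
  then have "msat M e (induction_fm \<phi>)" using msat_All_powD[of M n "induction_fm \<phi>"] PA by blast
  moreover have "(\<lambda>n. meval M (case_nat b e) (case n of 0 \<Rightarrow> Succ (Var 0) | Suc n \<Rightarrow> Var (Suc n))) =
      case_nat (suc M b) e" for b
    by (auto simp: fun_eq_iff split: nat.split)
  ultimately show ?thesis using assms by (simp add: induction_fm_def msat_inst1 msat_subst)
qed

lemma induct_rel:
  assumes "rel M \<phi> (zero M # xs)" "\<And>a. rel M \<phi> (a # xs) \<Longrightarrow> rel M \<phi> (suc M a # xs)"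
  shows "rel M \<phi> (a # xs)"
  using induct[of "lenv xs (\<lambda>_. zero M)" \<phi> a] assms by (simp add: rel_def)

lemma Robinson: "\<phi> \<in> Robinson \<Longrightarrow> rel M \<phi> []"
  unfolding rel_def by (rule PA) (simp add: PA_def)

lemma suc_neq_zero [simp]: "suc M a \<noteq> zero M"
  using Robinson[of "All (Neg (Eq (Succ (Var 0)) Zero))"] by (simp add: Robinson_def)

lemma suc_inject [simp]: "suc M a = suc M b \<longleftrightarrow> a = b"
  using Robinson[of "All (All (Imp (Eq (Succ (Var 1)) (Succ (Var 0))) (Eq (Var 1) (Var 0))))"]
  by (auto simp: Robinson_def)

lemma plus_zero [simp]: "plus M a (zero M) = a"
  using Robinson[of "All (Eq (Plus (Var 0) Zero) (Var 0))"] by (simp add: Robinson_def)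

lemma plus_suc [simp]: "plus M a (suc M b) = suc M (plus M a b)"
  using Robinson[of "All (All (Eq (Plus (Var 1) (Succ (Var 0))) (Succ (Plus (Var 1) (Var 0)))))"]
  by (simp add: Robinson_def)

lemma times_zero [simp]: "times M a (zero M) = zero M"
  using Robinson[of "All (Eq (Times (Var 0) Zero) Zero)"] by (simp add: Robinson_def)

lemma times_suc [simp]: "times M a (suc M b) = plus M (times M a b) a"
  using Robinson[of "All (All (Eq (Times (Var 1) (Succ (Var 0))) (Plus (Times (Var 1) (Var 0)) (Var 1))))"]
  by (simp add: Robinson_def)

lemma not_less_zero [simp]: "\<not> less M a (zero M)"
  using Robinson[of "All (Neg (Less (Var 0) Zero))"] by (simp add: Robinson_def)

lemma less_suc: "less M a (suc M b) \<longleftrightarrow> less M a b \<or> a = b"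
  using Robinson[of "All (All (Iff (Less (Var 1) (Succ (Var 0)))
                   (Disj (Less (Var 1) (Var 0)) (Eq (Var 1) (Var 0)))))"]
  by (simp add: Robinson_def) blast

lemma less_trans: "less M a b \<Longrightarrow> less M b c \<Longrightarrow> less M a c"
  using induct_rel[of "Imp (Less (Var 2) (Var 0)) (Less (Var 1) (Var 0))" "[a, b]" c]
  by (auto simp: less_suc)

lemma zero_less_suc: "less M (zero M) (suc M a)"
  using induct_rel[of "Less Zero (Succ (Var 0))" "[]" a] by (auto simp: less_suc)

lemma suc_less: "less M b a \<Longrightarrow> less M (suc M b) a \<or> suc M b = a"
  using induct_rel[of "Imp (Less (Var 1) (Var 0))
    (Disj (Less (Succ (Var 1)) (Var 0)) (Eq (Succ (Var 1)) (Var 0)))" "[b]" a]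
  by (auto simp: less_suc)

lemma less_linear: "less M a b \<or> a = b \<or> less M b a"
proof -
  have *: "less M a (zero M) \<or> a = zero M \<or> less M (zero M) a"
    using induct_rel[of "Disj (Eq (Var 0) Zero) (Less Zero (Var 0))" "[]" a] zero_less_suc by auto
  have "rel M (Disj (Less (Var 1) (Var 0)) (Disj (Eq (Var 1) (Var 0)) (Less (Var 0) (Var 1)))) [b, a]"
    by (rule induct_rel) (use * in \<open>auto simp: less_suc dest: suc_less\<close>)
  then show ?thesis by auto
qed

lemma least:
  assumes "rel M \<phi> (a # xs)"
  shows "\<exists>a. rel M \<phi> (a # xs) \<and> (\<forall>b. less M b a \<longrightarrow> \<not> rel M \<phi> (b # xs))"
proof (rule ccontr)
  assume no: "\<not> ?thesis"
  \<comment> \<open>The bounded quantifier below inserts the bound as variable 1, so the parameters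
    of \<open>\<phi>\<close> move up by one while variable 0 stays.\<close>
  define \<sigma> where "\<sigma> = case_nat (Var 0) (\<lambda>n. Var (Suc (Suc n)))"
  have "(\<lambda>n. meval M (case_nat b (case_nat a e)) (\<sigma> n)) = case_nat b e" for a b e
    by (auto simp: \<sigma>_def fun_eq_iff split: nat.split)
  then have *: "rel M (subst \<sigma> \<phi>) (b # a # xs) \<longleftrightarrow> rel M \<phi> (b # xs)" for a b
    by (simp add: rel_def msat_subst)
  have "rel M (BAll (Var 0) (Neg (subst \<sigma> \<phi>))) (suc M a # xs)"
    by (rule induct_rel) (use no in \<open>auto simp: * less_suc\<close>)
  then show False using assms by (auto simp: * less_suc)
qed

lemma mnum_inject [simp]: "mnum M m = mnum M n \<longleftrightarrow> m = n"
proof (induction m arbitrary: n)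
  case 0
  then show ?case using suc_neq_zero by (cases n) (auto dest: sym)
next
  case (Suc m)
  then show ?case by (cases n) auto
qed

lemma mnum_plus [simp]: "plus M (mnum M m) (mnum M n) = mnum M (m + n)"
  by (induction n) auto

lemma mnum_times [simp]: "times M (mnum M m) (mnum M n) = mnum M (m * n)"
  by (induction n) (auto simp: add.commute)

text \<open>The standard numbers form an initial segment of every model. All transfer between the
  standard and a nonstandard model rests on this.\<close>

lemma less_mnum: "less M a (mnum M n) \<longleftrightarrow> (\<exists>k<n. a = mnum M k)"
  by (induction n) (auto simp: less_suc less_Suc_eq)

lemma eval_abs: "meval M (\<lambda>n. mnum M (e n)) t = mnum M (eval e t)"
  by (induction t) auto

text \<open>With standard parameters, a bounded quantifier has a standard bound and hence ranges
  over standard numbers only.\<close>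

lemma Delta0_sat: "Delta0 \<phi> \<Longrightarrow> msat M (\<lambda>n. mnum M (e n)) \<phi> \<longleftrightarrow> sat e \<phi>"
proof (induction arbitrary: e rule: Delta0.induct)
  case (5 \<phi> t)
  have "case_nat (mnum M k) (\<lambda>n. mnum M (e n)) = (\<lambda>n. mnum M (case_nat k e n))" for k
    by (auto simp: fun_eq_iff split: nat.split)
  then show ?case by (auto simp: 5 eval_abs less_mnum)
qed (auto simp: eval_abs less_mnum)

end

section \<open>The standard model\<close>

definition std :: "nat arith" where
  "std = \<lparr>zero = 0, suc = Suc, plus = (+), times = (*), less = (<)\<rparr>"

lemma std_simps [simp]:
  "zero std = 0" "suc std = Suc" "plus std = (+)" "times std = (*)" "less std = (<)"
  by (simp_all add: std_def)

lemma mnum_std [simp]: "mnum std n = n"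
  by (induction n) auto

lemma meval_std [simp]: "meval std e t = eval e t"
  by (induction t) auto

lemma msat_std [simp]: "msat std e \<phi> \<longleftrightarrow> sat e \<phi>"
  by (induction \<phi> arbitrary: e) auto

interpretation std: PA_model std
  by unfold_locales (simp add: sat_PA)

lemma (in PA_model) Delta0_rel:
  "Delta0 \<phi> \<Longrightarrow> rel M \<phi> (map (mnum M) ns) \<longleftrightarrow> rel std \<phi> ns"
proof -
  have "lenv (map (mnum M) ns) (\<lambda>_. zero M) = (\<lambda>n. mnum M (lenv ns (\<lambda>_. 0) n))"
    by (induction ns) (auto simp: fun_eq_iff split: nat.split)
  then show "Delta0 \<phi> \<Longrightarrow> ?thesis" by (simp add: rel_def Delta0_sat)
qed

lemma PA_sentence: "\<phi> \<in> PA \<Longrightarrow> sentence \<phi>"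
  by (auto simp: PA_def Robinson_def)

text \<open>\<open>B\<close> bounds all unbounded quantifiers of \<open>\<phi>\<close> by its additional first variable.\<close>

definition bounds :: "fm \<Rightarrow> fm \<Rightarrow> nat \<Rightarrow> bool" where
  "bounds B \<phi> n \<longleftrightarrow> Delta0 B \<and> fwf (Suc n) B \<and>
     (\<forall>M :: nat arith. PA_model M \<longrightarrow> (\<forall>xs. length xs = n \<longrightarrow>
        (rel M \<phi> xs \<longleftrightarrow> (\<exists>t. rel M B (t # xs))) \<and>
        (\<forall>t t'. less M t t' \<longrightarrow> rel M B (t # xs) \<longrightarrow> rel M B (t' # xs))))"

text \<open>Each new existential quantifier is bounded by the variable that already bounds the
  others; monotonicity allows this common bound to grow beyond the new witness.\<close>

lemma Sigma1_bounds: "Sigma1 \<phi> \<Longrightarrow> fwf n \<phi> \<Longrightarrow> \<exists>B. bounds B \<phi> n"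
proof (induction arbitrary: n rule: Sigma1.induct)
  case (1 \<phi>)
  have "rel M (lift \<phi>) (t # xs) \<longleftrightarrow> rel M \<phi> xs" for M :: "nat arith" and t xs
    by (simp add: rel_def)
  moreover have "fwf (Suc n) (lift \<phi>)" unfolding lift_def by (rule fwf_subst[OF 1(2)]) simp
  ultimately show ?case
    using Delta0_subst[OF 1(1)] unfolding bounds_def by (intro exI[of _ "lift \<phi>"]) (auto simp: lift_def)
next
  case (2 \<phi>)
  then obtain B where B: "bounds B \<phi> (Suc n)" by auto
  then have wf: "fwf (Suc (Suc n)) B" by (simp add: bounds_def)
  \<comment> \<open>The first two variables are swapped: \<open>B\<close> expects its bound first,
    but under the new quantifier the witness comes first.\<close>
  define ts where "ts = Var 1 # Var 0 # map (\<lambda>i. Var (Suc (Suc i))) [0..<n]"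
  have ts: "rel M (inst ts B) (a # t # xs) \<longleftrightarrow> rel M B (t # a # xs)"
    if "length xs = n" for M :: "nat arith" and a t xs
  proof -
    have "map (\<lambda>i. lenv xs (\<lambda>_. zero M) i) [0..<n] = xs"
      using that by (intro nth_equalityI) (auto simp: lenv_nth)
    then show ?thesis using wf by (subst rel_inst) (auto simp: ts_def comp_def)
  qed
  have "bounds (BEx (Var 0) (inst ts B)) (Ex \<phi>) n"
    unfolding bounds_def
  proof (intro conjI allI impI)
    have "Delta0 (inst ts B)" using B by (simp add: bounds_def Delta0_inst)
    then show "Delta0 (BEx (Var 0) (inst ts B))" by (intro Delta0.intros)
    have "fwf (Suc (Suc n)) (inst ts B)" using wf by (intro fwf_inst) (auto simp: ts_def)
    then show "fwf (Suc n) (BEx (Var 0) (inst ts B))" by (simp add: tlift_def)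
  next
    fix M :: "nat arith" and xs :: "nat list" and t t'
    assume M: "PA_model M" and xs: "length xs = n" and "less M t t'"
    interpret PA_model M by fact
    have "less M a t'" if "less M a t" for a using that \<open>less M t t'\<close> less_trans by blast
    then show "rel M (BEx (Var 0) (inst ts B)) (t # xs) \<Longrightarrow> rel M (BEx (Var 0) (inst ts B)) (t' # xs)"
      using B M xs \<open>less M t t'\<close> unfolding bounds_def by (simp add: ts) (metis length_Cons)
  next
    fix M :: "nat arith" and xs :: "nat list"
    assume M: "PA_model M" and xs: "length xs = n"
    interpret PA_model M by fact
    have B': "rel M \<phi> (a # xs) \<longleftrightarrow> (\<exists>t. rel M B (t # a # xs))"
      "less M t t' \<Longrightarrow> rel M B (t # a # xs) \<Longrightarrow> rel M B (t' # a # xs)" for a t t'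
      using B M xs unfolding bounds_def by (metis length_Cons)+
    have "(\<exists>a t. rel M B (t # a # xs)) \<longleftrightarrow> (\<exists>t a. less M a t \<and> rel M B (t # a # xs))"
    proof
      assume "\<exists>a t. rel M B (t # a # xs)"
      then obtain a t where at: "rel M B (t # a # xs)" by blast
      \<comment> \<open>Either \<open>t\<close> already exceeds the witness \<open>a\<close>, or
        \<open>suc M a\<close> exceeds both.\<close>
      have "less M a t \<or> (less M t (suc M a) \<and> less M a (suc M a))"
        using less_linear[of a t] by (auto simp: less_suc)
      then show "\<exists>t a. less M a t \<and> rel M B (t # a # xs)" using at B'(2) by blast
    qed blast
    then show "rel M (Ex \<phi>) xs \<longleftrightarrow> (\<exists>t. rel M (BEx (Var 0) (inst ts B)) (t # xs))"
      using xs by (simp add: B'(1) ts)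
  qed
  then show ?case by blast
qed

text \<open>\<open>Neg (All \<phi>)\<close> need not have the syntactic shape of a
  \<open>Sigma1\<close> formula, so an equivalent formula is built with \<open>Ex\<close>.\<close>

lemma Pi1_negation:
  "Pi1 \<phi> \<Longrightarrow> \<exists>\<psi>. Sigma1 \<psi> \<and> (\<forall>n. fwf n \<phi> \<longrightarrow> fwf n \<psi>) \<and>
     (\<forall>(M :: nat arith) e. msat M e \<psi> \<longleftrightarrow> \<not> msat M e \<phi>)"
proof (induction rule: Pi1.induct)
  case (1 \<phi>)
  then show ?case by (intro exI[of _ "Neg \<phi>"]) (auto intro: Sigma1.intros Delta0.intros)
next
  case (2 \<phi>)
  then obtain \<psi> where "Sigma1 \<psi>" "\<forall>n. fwf n \<phi> \<longrightarrow> fwf n \<psi>"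
    "\<forall>(M :: nat arith) e. msat M e \<psi> \<longleftrightarrow> \<not> msat M e \<phi>" by blast
  then show ?case by (intro exI[of _ "Ex \<psi>"]) (auto intro: Sigma1.intros)
qed

section \<open>Kolmogorov complexity in models of Peano arithmetic\<close>

definition pow2_length :: "'a arith \<Rightarrow> 'a \<Rightarrow> 'a \<Rightarrow> bool" where
  "pow2_length M a u \<longleftrightarrow> rel M (pow2_length_fm (Var 0) (Var 1)) [a, u]"

lemma rel_pow2_length_fm [simp]:
  "rel M (pow2_length_fm s t) xs \<longleftrightarrow> pow2_length M (rev_tm M s xs) (rev_tm M t xs)"
  by (simp add: pow2_length_def pow2_length_fm_def pow2_fm_def)

lemma Delta0_pow2_length_fm: "Delta0 (pow2_length_fm s t)"
  unfolding pow2_length_fm_def pow2_fm_def by (intro Delta0.intros)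

lemma fwf_pow2_length_fm: "twf n s \<Longrightarrow> twf n t \<Longrightarrow> fwf n (pow2_length_fm s t)"
  by (simp add: pow2_length_fm_def pow2_fm_def)

lemma pow2_length_std: "pow2_length std (code p) u \<longleftrightarrow> u = 2 ^ length p"
  unfolding pow2_length_def rel_def by (simp add: sat_pow2_length_fm)

context PA_model
begin

lemma pow2_length_bounds: "pow2_length M a u \<Longrightarrow> less M u (suc M (suc M a)) \<and> less M (suc M a) (plus M u u)"
  unfolding pow2_length_def pow2_length_fm_def by simp

lemma pow2_length_mnum: "pow2_length M (mnum M k) (mnum M u) \<longleftrightarrow> pow2_length std k u"
  using Delta0_rel[OF Delta0_pow2_length_fm, of "Var 0" "Var 1" "[k, u]"] by simp

lemma rel_length_less_fm:
  "rel M (length_less_fm t c) xs \<longleftrightarrow> (\<exists>u. pow2_length M (rev_tm M t xs) u \<and> less M u (mnum M (2 ^ c)))"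
  by (simp add: length_less_fm_def)

text \<open>Even in a nonstandard model, the strings of length less than \<open>c\<close> are just
  the standard ones: \<open>u\<close> is standard below a numeral, and so is \<open>a\<close> by
  \<open>a + 1 < 2u\<close>. Absoluteness of bounded formulas then reduces the claim to actual
  strings.\<close>

lemma length_less_iff:
  "(\<exists>u. pow2_length M a u \<and> less M u (mnum M (2 ^ c))) \<longleftrightarrow> (\<exists>k. k + 1 < 2 ^ c \<and> a = mnum M k)"
proof
  assume "\<exists>u. pow2_length M a u \<and> less M u (mnum M (2 ^ c))"
  then obtain j where j: "j < 2 ^ c" "pow2_length M a (mnum M j)" by (auto simp: less_mnum)
  then obtain i where "suc M a = mnum M i" using pow2_length_bounds by (fastforce simp: less_mnum)
  then obtain k where k: "a = mnum M k" by (cases i) auto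
  obtain p where p: "code p = k" using code_surj by blast
  have "j = 2 ^ length p" using j(2) k p pow2_length_mnum pow2_length_std by metis
  then have "length p < c" using j(1) by simp
  then have "(2::nat) ^ Suc (length p) \<le> 2 ^ c" by (intro power_increasing) auto
  then show "\<exists>k. k + 1 < 2 ^ c \<and> a = mnum M k" using k p code_length[of p] by auto
next
  assume "\<exists>k. k + 1 < 2 ^ c \<and> a = mnum M k"
  then obtain k where k: "k + 1 < 2 ^ c" "a = mnum M k" by blast
  obtain p where p: "code p = k" using code_surj by blast
  have "pow2_length M a (mnum M (2 ^ length p))" using k p pow2_length_mnum pow2_length_std by metis
  moreover have "(2::nat) ^ length p < 2 ^ c" using k p code_length[of p] by linarith
  ultimately show "\<exists>u. pow2_length M a u \<and> less M u (mnum M (2 ^ c))" by (auto simp: less_mnum)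
qed

text \<open>The number \<open>2 ^ l - 1\<close> codes a string of length \<open>l\<close>, so the
  other string has length at most \<open>l + d < 2 * l\<close>. In the model this is computed with
  the powers of two \<open>u\<close> and \<open>v\<close> that represent the lengths.\<close>

lemma length_le_fm_imp_less:
  assumes "rel M (length_le_fm s t d) xs" "rev_tm M t xs = mnum M (2 ^ l - 1)" "d < l"
  shows "\<exists>k. k + 1 < 2 ^ (2 * l) \<and> rev_tm M s xs = mnum M k"
proof -
  obtain u v where uv: "pow2_length M (rev_tm M s xs) u" "pow2_length M (mnum M (2 ^ l - 1)) v"
      "less M u (suc M (times M (mnum M (2 ^ d)) v))"
    using assms(1,2) by (auto simp: length_le_fm_def)
  \<comment> \<open>The power \<open>v\<close> is at most \<open>(2 ^ l - 1) + 1\<close>, hence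
    standard.\<close>
  have "less M v (mnum M (Suc (2 ^ l)))" using pow2_length_bounds[OF uv(2)] by (simp flip: mnum.simps)
  then obtain k where k: "k \<le> 2 ^ l" "v = mnum M k"
    unfolding less_mnum less_Suc_eq_le by blast
  have "less M u (mnum M (Suc (2 ^ d * k)))" using uv(3) k(2) by simp
  then obtain j where j: "j \<le> 2 ^ d * k" "u = mnum M j"
    unfolding less_mnum less_Suc_eq_le by blast
  have "j \<le> 2 ^ d * 2 ^ l" using j(1) k(1) by (meson le_trans mult_le_mono2)
  also have "\<dots> = 2 ^ (d + l)" by (simp add: power_add)
  also have "\<dots> < 2 ^ (2 * l)" using assms(3) by (intro power_strict_increasing) auto
  finally have "less M u (mnum M (2 ^ (2 * l)))" using j(2) less_mnum by blast
  then show ?thesis using uv(1) length_less_iff by blast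
qed

text \<open>In every model, the axiom speaks about finitely many standard programs only.\<close>

lemma rel_KC_ge_fm:
  assumes "fwf (Suc (Suc (Suc 0))) \<upsilon>"
  shows "rel M (KC_ge_fm \<upsilon> x y c) [] \<longleftrightarrow>
    (\<forall>k. k + 1 < 2 ^ c \<longrightarrow> \<not> rel M \<upsilon> [mnum M k, mnum M (code y), mnum M (code x)])"
  using assms length_less_iff by (auto simp: KC_ge_fm_def rel_inst rel_length_less_fm)

end

lemma sentence_KC_ge_fm: "fwf (Suc (Suc (Suc 0))) \<upsilon> \<Longrightarrow> sentence (KC_ge_fm \<upsilon> x y c)"
  by (simp add: KC_ge_fm_def length_less_fm_def fwf_pow2_length_fm fwf_inst)

section \<open>The represented interpreter in the standard model\<close>

locale represented_interpreter =
  fixes \<upsilon> :: fm and U :: interpreter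
  assumes representation: "natural_representation \<upsilon> U"
begin

lemma fwf_interp: "fwf (Suc (Suc (Suc 0))) \<upsilon>"
  using representation by (simp add: natural_representation_def numeral_3_eq_3)

lemma rel_std_interp: "rel std \<upsilon> [code p, code y, code x] \<longleftrightarrow> U p y = Some x"
proof -
  have "sat e (inst [num (code p), num (code y), num (code x)] \<upsilon>) \<longleftrightarrow>
      rel std \<upsilon> [code p, code y, code x]" for e
    using msat_eq_rel[of "[code p, code y, code x]" \<upsilon> std e] msat_inst[of std e] fwf_interp by simp
  then show ?thesis
    using representation unfolding natural_representation_def true_in_N_def by blast
qed

lemma rel_std_functional: "rel std \<upsilon> [k, n, m] \<Longrightarrow> rel std \<upsilon> [k, n, m'] \<Longrightarrow> m = m'"
  by (metis code_surj option.inject rel_std_interp)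

text \<open>Finitely many programs, each with at most one output, cannot produce all
  strings.\<close>

lemma exists_complex: "\<exists>m. \<forall>k. k + 1 < 2 ^ c \<longrightarrow> \<not> rel std \<upsilon> [k, n, m]"
proof -
  have "{m. \<exists>k. k + 1 < 2 ^ c \<and> rel std \<upsilon> [k, n, m]} = (\<Union>k\<in>{k. k + 1 < 2 ^ c}. {m. rel std \<upsilon> [k, n, m]})"
    by auto
  moreover have "finite {m. rel std \<upsilon> [k, n, m]}" for k
  proof (cases "\<exists>m. rel std \<upsilon> [k, n, m]")
    case True
    then obtain m where "rel std \<upsilon> [k, n, m]" by blast
    then have "{m. rel std \<upsilon> [k, n, m]} = {m}" using rel_std_functional by auto
    then show ?thesis by simp
  qed simp
  moreover have "finite {k::nat. k + 1 < 2 ^ c}" by (rule finite_subset[of _ "{..<2 ^ c}"]) auto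
  ultimately have "finite {m. \<exists>k. k + 1 < 2 ^ c \<and> rel std \<upsilon> [k, n, m]}" by simp
  then show ?thesis using ex_new_if_finite[OF infinite_UNIV_nat] by fastforce
qed

end

section \<open>The interpreter that waits for a refutation\<close>

locale refutation_search = represented_interpreter +
  fixes B \<theta> :: fm
  assumes bounds: "bounds B \<upsilon> 3" and Delta0_\<theta>: "Delta0 \<theta>" and fwf_\<theta>: "fwf (Suc (Suc 0)) \<theta>"
begin

lemma fwf_B: "fwf (Suc (Suc (Suc (Suc 0)))) B"
  using bounds by (simp add: bounds_def numeral_3_eq_3)

lemma Delta0_B: "Delta0 B"
  using bounds by (simp add: bounds_def)

lemma rel_interp: "PA_model (M :: nat arith) \<Longrightarrow> rel M \<upsilon> [q, y, x] \<longleftrightarrow> (\<exists>t. rel M B [t, q, y, x])"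
  using bounds unfolding bounds_def by (auto simp: numeral_3_eq_3)

text \<open>Reading \<open>B\<close> as "by time \<open>t\<close>, program \<open>q\<close> is seen
  to map \<open>y\<close> to \<open>x\<close>", what has been seen remains seen.\<close>

lemma rel_B_mono:
  "PA_model (M :: nat arith) \<Longrightarrow> less M t t' \<Longrightarrow> rel M B [t, q, y, x] \<Longrightarrow> rel M B [t', q, y, x]"
  using bounds unfolding bounds_def by (auto simp: numeral_3_eq_3)

text \<open>After \<open>t\<close> steps, no program below \<open>p (p + 2)\<close> is known to map \<open>y\<close> to \<open>x\<close>.
  For \<open>p = 2^l - 1\<close>, the code of a string of length \<open>l\<close>, these are the programs of length
  less than \<open>2 l\<close>.  The variables are \<open>t, p, y, x\<close>.\<close>

definition complex_fm :: fm where
  "complex_fm = BAll (Times (Var 1) (Succ (Succ (Var 1)))) (Neg (inst [Var 1, Var 0, Var 3, Var 4] B))"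

text \<open>The minimality clauses for \<open>t\<close> and for \<open>x\<close> make the output
  unique.\<close>

definition search_step_fm :: fm where
  "search_step_fm =
     Conj (inst [Var 0, Var 2] \<theta>)
    (Conj (BAll (Var 0) (Neg (inst [Var 0, Var 3] \<theta>)))
    (Conj complex_fm
          (BAll (Var 3) (Neg (inst [Var 1, Var 2, Var 3, Var 0] complex_fm)))))"

text \<open>Program \<open>p\<close> waits until condition \<open>y\<close> is refuted and then outputs the first string
  that still looks complex given \<open>y\<close>.\<close>

definition search_fm :: fm where
  "search_fm = Ex search_step_fm"

lemma fwf_complex_fm: "fwf (Suc (Suc (Suc (Suc 0)))) complex_fm"
  by (simp add: complex_fm_def fwf_inst fwf_B numeral_eq_Suc)

lemma fwf_search_fm: "fwf (Suc (Suc (Suc 0))) search_fm"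
  by (simp add: search_fm_def search_step_fm_def fwf_complex_fm fwf_inst fwf_\<theta> numeral_eq_Suc)

lemma Delta0_complex_fm: "Delta0 complex_fm"
  unfolding complex_fm_def by (intro Delta0.intros Delta0_inst Delta0_B)

lemma Sigma1_search_fm: "Sigma1 search_fm"
  unfolding search_fm_def search_step_fm_def
  by (intro Sigma1.intros Delta0.intros Delta0_inst Delta0_complex_fm Delta0_\<theta>)

lemma rel_complex_fm:
  "rel M complex_fm [t, p, y, x] \<longleftrightarrow>
     (\<forall>q. less M q (times M p (suc M (suc M p))) \<longrightarrow> \<not> rel M B [t, q, y, x])"
  by (simp add: complex_fm_def rel_inst fwf_B)

lemma rel_search_fm:
  "rel M search_fm [p, y, x] \<longleftrightarrow> (\<exists>t. rel M \<theta> [t, y] \<and> (\<forall>s. less M s t \<longrightarrow> \<not> rel M \<theta> [s, y]) \<and>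
     rel M complex_fm [t, p, y, x] \<and> (\<forall>z. less M z x \<longrightarrow> \<not> rel M complex_fm [t, p, y, z]))"
  by (auto simp: search_fm_def search_step_fm_def rel_inst fwf_\<theta> fwf_complex_fm)

text \<open>Provable functionality is what admits \<open>search_fm\<close> to the optimality clause
  of \<open>natural_representation\<close>. In a model, two least elements coincide by linearity of
  the order.\<close>

lemma functional_search_fm: "PA \<turnstile> functional_fm search_fm"
proof (rule completeness)
  show "Robinson \<subseteq> PA" by (simp add: PA_def)
  show "\<forall>\<chi>\<in>PA. sentence \<chi>" using PA_sentence by blast
  show wf: "sentence (functional_fm search_fm)"
    by (simp add: functional_fm_def fwf_inst fwf_search_fm numeral_eq_Suc)
  fix M :: "nat arith" and e
  assume "\<forall>\<chi>\<in>PA. msat M e \<chi>"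
  then interpret PA_model M
    using PA_sentence msat_sentence by unfold_locales blast
  have "x = x'" if "rel M search_fm [p, y, x]" "rel M search_fm [p, y, x']" for p y x x'
    using that less_linear unfolding rel_search_fm by metis
  then show "msat M e (functional_fm search_fm)"
    by (simp add: rel_sentence[OF wf]) (simp add: functional_fm_def rel_inst fwf_search_fm)
qed

text \<open>Optimality enters here. It is provable in PA and not merely true, so one standard
  \<open>d\<close> serves in all models.\<close>

lemma simulation:
  obtains d where "\<And>(M :: nat arith) p y x. PA_model M \<Longrightarrow> rel M search_fm [p, y, x] \<Longrightarrow>
    \<exists>q. rel M (length_le_fm (Var 0) (Var 3) d) [q, x, y, p] \<and> rel M \<upsilon> [q, y, x]"
proof -
  obtain d where d: "PA \<turnstile> simulates_fm \<upsilon> search_fm d"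
    using representation Sigma1_search_fm fwf_search_fm functional_search_fm
    unfolding natural_representation_def numeral_3_eq_3 by blast
  have "rel M (simulates_fm \<upsilon> search_fm d) []" if "PA_model M" for M :: "nat arith"
    using proves_msat[OF d] PA_model.PA[OF that] unfolding rel_def by blast
  then have "\<exists>q. rel M (length_le_fm (Var 0) (Var 3) d) [q, x, y, p] \<and> rel M \<upsilon> [q, y, x]"
    if "PA_model M" "rel M search_fm [p, y, x]" for M :: "nat arith" and p y x
    using that by (simp add: simulates_fm_def rel_inst fwf_search_fm fwf_interp)
  then show ?thesis by (rule that)
qed

lemma uniform_bound:
  assumes "\<And>m'. m' < m \<Longrightarrow> \<exists>k. k + 1 < N \<and> rel std \<upsilon> [k, n, m']"
  shows "\<exists>T. \<forall>m'<m. \<exists>k. k + 1 < N \<and> rel std B [T, k, n, m']"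
  using assms
proof (induction m)
  case (Suc m)
  then obtain T where T: "\<forall>m'<m. \<exists>k. k + 1 < N \<and> rel std B [T, k, n, m']" by auto
  obtain k t where k: "k + 1 < N" "rel std B [t, k, n, m]"
    using Suc.prems[of m] rel_interp[OF std.PA_model_axioms] by auto
  \<comment> \<open>\<open>rel_B_mono\<close> needs a strictly later time, hence the successor of
    the sum of both times.\<close>
  have "rel std B [s, k, n, m'] \<Longrightarrow> rel std B [Suc (s + s'), k, n, m']" for s s' k m'
    using rel_B_mono[OF std.PA_model_axioms, of s "Suc (s + s')"] by simp
  then have "\<forall>m'<Suc m. \<exists>k. k + 1 < N \<and> rel std B [Suc (T + t), k, n, m']"
    using T k by (metis add.commute less_Suc_eq)
  then show ?case ..
qed simp

text \<open>For an unrefuted \<open>n\<close>, a single true axiom on the complexity of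
  \<open>m\<close> given \<open>n\<close> rules out refutations of \<open>n\<close> in all models.
  The constant \<open>c\<close> is chosen before \<open>n\<close>.\<close>

theorem refutation_excluded:
  "\<exists>c. \<forall>n. (\<forall>t. \<not> rel std \<theta> [t, n]) \<longrightarrow>
    (\<exists>m. (\<forall>k. k + 1 < 2 ^ c \<longrightarrow> \<not> rel std \<upsilon> [k, n, m]) \<and>
      (\<forall>M :: nat arith. PA_model M \<longrightarrow>
        (\<forall>k. k + 1 < 2 ^ c \<longrightarrow> \<not> rel M \<upsilon> [mnum M k, mnum M n, mnum M m]) \<longrightarrow>
        (\<forall>t. \<not> rel M \<theta> [t, mnum M n])))"
proof -
  obtain d where d: "\<And>(M :: nat arith) p y x. PA_model M \<Longrightarrow> rel M search_fm [p, y, x] \<Longrightarrow>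
    \<exists>q. rel M (length_le_fm (Var 0) (Var 3) d) [q, x, y, p] \<and> rel M \<upsilon> [q, y, x]"
    using simulation by blast
  \<comment> \<open>With \<open>l > d\<close>, the simulation of a program of length
    \<open>l\<close> is shorter than \<open>c = 2 * l\<close>; \<open>p\<close> codes such a
    program.\<close>
  define l where "l = Suc d"
  define c where "c = 2 * l"
  define p :: nat where "p = 2 ^ l - 1"
  \<comment> \<open>The search bound \<open>p * (p + 2)\<close> equals
    \<open>(p + 1) * (p + 1) - 1\<close>, that is, \<open>2 ^ c - 1\<close>.\<close>
  have p: "q < p * (p + 2) \<longleftrightarrow> q + 1 < 2 ^ c" for q
  proof -
    have "p + 1 = 2 ^ l" by (simp add: p_def)
    then have "2 ^ c = (p + 1) * (p + 1)" by (simp add: c_def mult_2 power_add)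
    then show ?thesis by (simp add: algebra_simps)
  qed
  have "\<exists>m. (\<forall>k. k + 1 < 2 ^ c \<longrightarrow> \<not> rel std \<upsilon> [k, n, m]) \<and>
      (\<forall>M :: nat arith. PA_model M \<longrightarrow>
        (\<forall>k. k + 1 < 2 ^ c \<longrightarrow> \<not> rel M \<upsilon> [mnum M k, mnum M n, mnum M m]) \<longrightarrow>
        (\<forall>t. \<not> rel M \<theta> [t, mnum M n]))"
    if n: "\<forall>t. \<not> rel std \<theta> [t, n]" for n
  proof -
    \<comment> \<open>Since \<open>m\<close> is least, every smaller string is the output of a short
      program, and one standard time \<open>T\<close> suffices to see this for all of them.\<close>
    define m where "m = (LEAST m. \<forall>k. k + 1 < 2 ^ c \<longrightarrow> \<not> rel std \<upsilon> [k, n, m])"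
    have m: "\<forall>k. k + 1 < 2 ^ c \<longrightarrow> \<not> rel std \<upsilon> [k, n, m]"
      unfolding m_def by (rule LeastI_ex[OF exists_complex])
    have "\<exists>k. k + 1 < 2 ^ c \<and> rel std \<upsilon> [k, n, m']" if "m' < m" for m'
      using not_less_Least[OF that[unfolded m_def]] by blast
    then obtain T where T: "\<forall>m'<m. \<exists>k. k + 1 < 2 ^ c \<and> rel std B [T, k, n, m']"
      using uniform_bound by blast
    have "\<not> rel M \<theta> [t, mnum M n]"
      if M: "PA_model M" and
        complex: "\<forall>k. k + 1 < 2 ^ c \<longrightarrow> \<not> rel M \<upsilon> [mnum M k, mnum M n, mnum M m]"
      for M :: "nat arith" and t
    proof
      interpret PA_model M by fact
      assume "rel M \<theta> [t, mnum M n]"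
      then obtain t where t: "rel M \<theta> [t, mnum M n]" "\<forall>s. less M s t \<longrightarrow> \<not> rel M \<theta> [s, mnum M n]"
        using least by blast
      \<comment> \<open>A refutation at a standard time would, by absoluteness, be a real
        one.\<close>
      have "\<not> less M t (mnum M T)"
        using t(1) n Delta0_rel[OF Delta0_\<theta>, of "[_, n]"] by (auto simp: less_mnum)
      then have Tt: "t = mnum M T \<or> less M (mnum M T) t" using less_linear by blast
      have times: "times M (mnum M p) (suc M (suc M (mnum M p))) = mnum M (p * (p + 2))"
        by (simp flip: mnum.simps)
      have "rel M complex_fm [t, mnum M p, mnum M n, mnum M m]"
        unfolding rel_complex_fm times less_mnum using complex p rel_interp[OF M] by blast
      moreover have "\<not> rel M complex_fm [t, mnum M p, mnum M n, z]" if z: "less M z (mnum M m)" for z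
      proof -
        obtain m' where m': "m' < m" "z = mnum M m'" using z less_mnum by blast
        then obtain k where k: "k + 1 < 2 ^ c" "rel std B [T, k, n, m']" using T by blast
        then have "rel M B [mnum M T, mnum M k, mnum M n, z]"
          using Delta0_rel[OF Delta0_B, of "[T, k, n, m']"] m' by simp
        then have "rel M B [t, mnum M k, mnum M n, z]" using Tt rel_B_mono[OF M] by blast
        then show ?thesis unfolding rel_complex_fm times less_mnum using k(1) p by blast
      qed
      \<comment> \<open>At time \<open>t\<close>, the first string that looks complex is
        \<open>m\<close>, so the search outputs it; simulation then yields a short program for
        \<open>m\<close>.\<close>
      ultimately have "rel M search_fm [mnum M p, mnum M n, mnum M m]"
        unfolding rel_search_fm using t by blast
      then obtain q where "rel M (length_le_fm (Var 0) (Var 3) d) [q, mnum M m, mnum M n, mnum M p]"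
          and q: "rel M \<upsilon> [q, mnum M n, mnum M m]"
        using d[OF M] by blast
      then obtain k where "k + 1 < 2 ^ c" "q = mnum M k"
        using length_le_fm_imp_less[of "Var 0" "Var 3" d "[q, mnum M m, mnum M n, mnum M p]" l]
        unfolding p_def c_def l_def by auto
      then show False using q complex by blast
    qed
    then show ?thesis using m by blast
  qed
  then show ?thesis by blast
qed

end

section \<open>Refutable lower bounds on complexity, and the two applications of the search\<close>

text \<open>The number \<open>z = (x + K)\<^sup>2 + x\<close> codes the pair of \<open>x\<close> and \<open>K\<close>; \<open>t\<close> refutes \<open>z\<close> by witnessing
  that some program below \<open>K\<close> outputs \<open>x\<close> on the empty condition.  The variables are \<open>t, z\<close>.\<close>

definition refute_fm :: "fm \<Rightarrow> fm" where
  "refute_fm B = BEx (Succ (Var 1)) (BEx (Succ (Var 2))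
     (Conj (Eq (Var 3) (Plus (Times (Plus (Var 1) (Var 0)) (Plus (Var 1) (Var 0))) (Var 1)))
           (BEx (Var 0) (inst [Var 3, Var 0, Zero, Var 2] B))))"

lemma Delta0_refute_fm: "Delta0 B \<Longrightarrow> Delta0 (refute_fm B)"
  unfolding refute_fm_def by (intro Delta0.intros Delta0_inst)

lemma fwf_refute_fm: "fwf (Suc (Suc (Suc (Suc 0)))) B \<Longrightarrow> fwf (Suc (Suc 0)) (refute_fm B)"
  by (simp add: refute_fm_def fwf_inst numeral_eq_Suc)

lemma rel_refute_fm:
  "fwf (Suc (Suc (Suc (Suc 0)))) B \<Longrightarrow> rel M (refute_fm B) [t, z] \<longleftrightarrow>
    (\<exists>x. less M x (suc M z) \<and> (\<exists>K. less M K (suc M z) \<and>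
      z = plus M (times M (plus M x K) (plus M x K)) x \<and>
      (\<exists>q. less M q K \<and> rel M B [t, q, zero M, x])))"
  by (auto simp: refute_fm_def rel_inst)

text \<open>Since \<open>x \<le> x + K\<close>, the code lies below the next square, so it
  determines \<open>x + K\<close>. This pairing is expressible by a term.\<close>

lemma square_pair_less:
  fixes x K x' K' :: nat
  assumes "x + K < x' + K'"
  shows "(x + K) * (x + K) + x < (x' + K') * (x' + K') + x'"
proof -
  have "(x + K) * (x + K) + x < Suc (x + K) * Suc (x + K)" by simp
  also have "\<dots> \<le> (x' + K') * (x' + K')" using assms by (intro mult_le_mono) auto
  finally show ?thesis by simp
qed

lemma square_pair_inject:
  fixes x K x' K' :: nat
  assumes "(x + K) * (x + K) + x = (x' + K') * (x' + K') + x'"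
  shows "x = x' \<and> K = K'"
proof -
  have "x + K = x' + K'"
    using square_pair_less[of x K x' K'] square_pair_less[of x' K' x K] assms
    by (metis less_irrefl linorder_neqE_nat)
  then show ?thesis using assms by simp
qed

theorem theorem13:
  fixes U :: interpreter and \<upsilon> :: fm
  assumes "optimal_interpreter U"
    and "natural_representation \<upsilon> U"
  shows "\<exists>c::nat. \<forall>\<phi>. sentence \<phi> \<and> Pi1 \<phi> \<and> true_in_N \<phi> \<longrightarrow>
           PA \<union> {KC_ge_fm \<upsilon> x y c | x y. true_in_N (KC_ge_fm \<upsilon> x y c)} \<turnstile> \<phi>"
proof -
  interpret represented_interpreter \<upsilon> U by unfold_locales (rule assms(2))
  have "Sigma1 \<upsilon>" using assms(2) by (simp add: natural_representation_def)
  then obtain B where B: "bounds B \<upsilon> 3" using Sigma1_bounds fwf_interp by (metis numeral_3_eq_3)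
  then have wfB: "fwf (Suc (Suc (Suc (Suc 0)))) B" and "Delta0 B" by (simp_all add: bounds_def numeral_3_eq_3)
  interpret complexity: refutation_search \<upsilon> U B "refute_fm B"
    using B wfB \<open>Delta0 B\<close> by unfold_locales (auto simp: Delta0_refute_fm fwf_refute_fm)
  \<comment> \<open>This constant is fixed before any sentence \<open>\<phi>\<close> is
    considered.\<close>
  obtain c where c: "\<forall>n. (\<forall>t. \<not> rel std (refute_fm B) [t, n]) \<longrightarrow>
    (\<exists>m. (\<forall>k. k + 1 < 2 ^ c \<longrightarrow> \<not> rel std \<upsilon> [k, n, m]) \<and>
      (\<forall>M :: nat arith. PA_model M \<longrightarrow>
        (\<forall>k. k + 1 < 2 ^ c \<longrightarrow> \<not> rel M \<upsilon> [mnum M k, mnum M n, mnum M m]) \<longrightarrow>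
        (\<forall>t. \<not> rel M (refute_fm B) [t, mnum M n])))"
    using complexity.refutation_excluded by blast
  let ?Ax = "{KC_ge_fm \<upsilon> x y c | x y. true_in_N (KC_ge_fm \<upsilon> x y c)}"
  have "PA \<union> ?Ax \<turnstile> \<phi>" if \<phi>: "sentence \<phi>" "Pi1 \<phi>" "true_in_N \<phi>" for \<phi>
  proof -
    obtain \<psi> where \<psi>: "Sigma1 \<psi>" "sentence \<psi>"
        "\<And>(M :: nat arith) e. msat M e \<psi> \<longleftrightarrow> \<not> msat M e \<phi>"
      using Pi1_negation[OF \<phi>(2)] \<phi>(1) by blast
    obtain D where D: "bounds D \<psi> 0" using Sigma1_bounds \<psi>(1,2) by blast
    then have wfD: "fwf (Suc 0) D" and "Delta0 D" by (simp_all add: bounds_def)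
    \<comment> \<open>\<open>D\<close> speaks about \<open>t\<close> only; the condition
      \<open>y\<close> is a dummy, set to 0 below.\<close>
    have rel_D: "rel M (inst [Var 0] D) [t, y] \<longleftrightarrow> rel M D [t]" for M :: "nat arith" and t y
      using wfD by (simp add: rel_inst)
    have rel_\<psi>: "rel M \<psi> [] \<longleftrightarrow> (\<exists>t. rel M D [t])" if "PA_model M" for M :: "nat arith"
      using D that by (simp add: bounds_def)
    interpret D: refutation_search \<upsilon> U B "inst [Var 0] D"
      using B wfD \<open>Delta0 D\<close> by unfold_locales (auto simp: Delta0_inst fwf_inst)
    have "\<forall>t. \<not> rel std (inst [Var 0] D) [t, 0]"
    proof -
      have "\<not> rel std \<psi> []" using \<phi>(3) \<psi>(3) by (simp add: rel_def true_in_N_def)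
      then show ?thesis using rel_\<psi>[OF std.PA_model_axioms] rel_D by simp
    qed
    \<comment> \<open>Here \<open>a\<close> depends on \<open>\<phi>\<close>. The second
      application, to the code \<open>z\<close> of \<open>x\<close> and \<open>K\<close>, removes
      this dependence.\<close>
    then obtain a x where x: "\<forall>k. k + 1 < 2 ^ a \<longrightarrow> \<not> rel std \<upsilon> [k, 0, x]"
        "\<And>M :: nat arith. PA_model M \<Longrightarrow>
          (\<forall>k. k + 1 < 2 ^ a \<longrightarrow> \<not> rel M \<upsilon> [mnum M k, zero M, mnum M x]) \<Longrightarrow>
          (\<forall>t. \<not> rel M D [t])"
      using D.refutation_excluded rel_D by (metis mnum.simps(1))
    \<comment> \<open>The numbers below \<open>K\<close> are exactly the codes of programs of length
      less than \<open>a\<close>.\<close>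
    define K :: nat where "K = 2 ^ a - 1"
    have K: "k < K \<longleftrightarrow> k + 1 < 2 ^ a" for k by (auto simp: K_def)
    define z where "z = (x + K) * (x + K) + x"
    have "\<not> rel std (refute_fm B) [t, z]" for t
    proof
      assume "rel std (refute_fm B) [t, z]"
      then obtain x' K' q where "z = (x' + K') * (x' + K') + x'" "q < K'" "rel std B [t, q, 0, x']"
        unfolding rel_refute_fm[OF wfB] by auto
      moreover from this(1) have "x = x' \<and> K = K'" unfolding z_def by (rule square_pair_inject)
      ultimately show False using x(1) K complexity.rel_interp[OF std.PA_model_axioms] by blast
    qed
    then obtain m where m: "\<forall>k. k + 1 < 2 ^ c \<longrightarrow> \<not> rel std \<upsilon> [k, z, m]"
      "\<And>M :: nat arith. PA_model M \<Longrightarrow>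
        (\<forall>k. k + 1 < 2 ^ c \<longrightarrow> \<not> rel M \<upsilon> [mnum M k, mnum M z, mnum M m]) \<Longrightarrow>
        (\<forall>t. \<not> rel M (refute_fm B) [t, mnum M z])"
      using c by blast
    obtain sm sz where codes: "code sm = m" "code sz = z" using code_surj by metis
    have "rel std (KC_ge_fm \<upsilon> sm sz c) []"
      using m(1) by (simp add: std.rel_KC_ge_fm[OF fwf_interp] codes)
    then have ax: "KC_ge_fm \<upsilon> sm sz c \<in> ?Ax"
      using rel_sentence[OF sentence_KC_ge_fm[OF fwf_interp], of std] by (auto simp: true_in_N_def)
    show ?thesis
    proof (rule completeness)
      show "Robinson \<subseteq> PA \<union> ?Ax" by (auto simp: PA_def)
      show "\<forall>\<chi>\<in>PA \<union> ?Ax. sentence \<chi>" using PA_sentence sentence_KC_ge_fm[OF fwf_interp] by blast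
      show "sentence \<phi>" by fact
      fix M :: "nat arith" and e
      assume M: "\<forall>\<chi>\<in>PA \<union> ?Ax. msat M e \<chi>"
      then interpret PA_model M
        using PA_sentence msat_sentence by unfold_locales blast
      have "msat M e (KC_ge_fm \<upsilon> sm sz c)" using M ax by blast
      then have "\<forall>k. k + 1 < 2 ^ c \<longrightarrow> \<not> rel M \<upsilon> [mnum M k, mnum M z, mnum M m]"
        using rel_sentence[OF sentence_KC_ge_fm[OF fwf_interp]] rel_KC_ge_fm[OF fwf_interp] codes by blast
      then have *: "\<not> rel M (refute_fm B) [t, mnum M z]" for t
        using m(2) PA_model_axioms by blast
      \<comment> \<open>A short program for \<open>x\<close> in \<open>M\<close> would refute
        \<open>z\<close> at some, possibly nonstandard, time \<open>t\<close>, which the axiom for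
        \<open>z\<close> excludes.\<close>
      have "\<not> rel M \<upsilon> [mnum M k, zero M, mnum M x]" if "k + 1 < 2 ^ a" for k
      proof
        assume "rel M \<upsilon> [mnum M k, zero M, mnum M x]"
        then obtain t where "rel M B [t, mnum M k, zero M, mnum M x]"
          using complexity.rel_interp[OF PA_model_axioms] by blast
        moreover have "less M (mnum M x) (mnum M (Suc z))" "less M (mnum M K) (mnum M (Suc z))"
          "less M (mnum M k) (mnum M K)"
          "mnum M z = plus M (times M (plus M (mnum M x) (mnum M K)) (plus M (mnum M x) (mnum M K))) (mnum M x)"
        proof -
          have "x \<le> z" "K \<le> z" unfolding z_def by (auto simp: algebra_simps trans_le_add1 trans_le_add2 le_square)
          then show "less M (mnum M x) (mnum M (Suc z))" "less M (mnum M K) (mnum M (Suc z))"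
            unfolding less_mnum by auto
          show "less M (mnum M k) (mnum M K)" using that K less_mnum by blast
          show "mnum M z = plus M (times M (plus M (mnum M x) (mnum M K)) (plus M (mnum M x) (mnum M K))) (mnum M x)"
            by (simp add: z_def)
        qed
        ultimately have "rel M (refute_fm B) [t, mnum M z]"
          unfolding rel_refute_fm[OF wfB] mnum.simps by blast
        then show False using * by blast
      qed
      then have "\<not> rel M \<psi> []" using x(2)[OF PA_model_axioms] rel_\<psi>[OF PA_model_axioms] by blast
      then show "msat M e \<phi>" using \<psi>(3) rel_sentence[OF \<psi>(2)] by blast
    qed
  qed
  then show ?thesis by blast
qed

end
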